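(* Let $p,q:\mathbb{R}^2\to\mathbb{R}$ be measurable functions with $1<p_-\le p_+<q_-\le q_+<\infty$, and let $\alpha,\beta:\mathbb{R}\to\mathbb{R}$ be measurable functions with $$\frac1{p_-}-\frac1{q_+}<\alpha_-\le\alpha_+<\frac1{p_-},\qquad \frac1{p_-}-\frac1{q_+}<\beta_-\le\beta_+<\frac1{p_-}.$$ Let $v$ be a weight on $\mathbb{R}^2$. Then there is a positive constant $c$ such that for all measurable $f$ on $\mathbb{R}^2$ $$\big\|(M^S_{\alpha(\cdot),\beta(\cdot)}f)\,v\big\|_{L^{q(\cdot)}(\mathbb{R}^2)}\le c\,\big\|f\,(\widetilde M_{\alpha(\cdot),\beta(\cdot)}v)\big\|_{L^{p(\cdot)}(\mathbb{R}^2)},$$ where $$(\widetilde M_{\alpha(\cdot),\beta(\cdot)}v)(x,y)=\max\big\{(\widetilde M^{(1)}_{\alpha(\cdot),\beta(\cdot)}v)(x,y),\ (\widetilde M^{(2)}_{\alpha(\cdot),\beta(\cdot)}v)(x,y)\big\},$$ $$(\widetilde M^{(1)}_{\alpha(\cdot),\beta(\cdot)}v)(x,y)=\sup_{I\ni x,\ J\ni y}|I\times J|^{-\frac1{p_-}}\big\|v(\cdot)|I|^{\alpha(\cdot)}|J|^{\beta(\cdot)}\big\|_{L^{q(\cdot)}(I\times J)},$$ $$(\widetilde M^{(2)}_{\alpha(\cdot),\beta(\cdot)}v)(x,y)=\sup_{I\ni x,\ J\ni y}|I\times J|^{-\frac1{p_+}}\big\|v(\cdot)|I|^{\alpha(\cdot)}|J|^{\beta(\cdot)}\big\|_{L^{q(\cdot)}(I\times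 J)}.$$
   Context: For a function $g$ on its domain, $g_-$ and $g_+$ denote its infimum and supremum. A weight is an a.e. positive measurable function. The norm of $L^{r(\cdot)}(E)$ is $\|f\|_{L^{r(\cdot)}(E)}=\inf\{\lambda>0:\int_E|f(x)/\lambda|^{r(x)}dx\le1\}$ (with value $+\infty$ allowed). Here $I,J$ range over bounded intervals of positive length in $\mathbb{R}$, and $v(\cdot)|I|^{\alpha(\cdot)}|J|^{\beta(\cdot)}$ denotes the function $(s,t)\mapsto v(s,t)|I|^{\alpha(s)}|J|^{\beta(t)}$. The strong fractional maximal operator of variable order is $$(M^S_{\alpha(\cdot),\beta(\cdot)}f)(x,y)=\sup_{I\ni x,\ J\ni y}|I|^{\alpha(x)-1}|J|^{\beta(y)-1}\iint_{I\times J}|f(t,\tau)|\,dt\,d\tau,\qquad (x,y)\in\mathbb{R}^2.$$ The convention $0\cdot\infty=0$ is used in products. *)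

theory Defs
  imports "HOL-Analysis.Analysis"
begin

text \<open>
  All maximal functions and norms take values in \<^typ>\<open>ennreal\<close>, where
  \<^prop>\<open>0 * (\<infinity>::ennreal) = 0\<close>. ``Measurable'' means Lebesgue measurable.
\<close>

text \<open>The power \<open>a\<^sup>r\<close>, used for \<open>r > 0\<close> only, so that the power of \<open>\<infinity>\<close> is \<open>\<infinity>\<close>.\<close>

definition ennpow :: "ennreal \<Rightarrow> real \<Rightarrow> ennreal" where
  "ennpow a r = (if a = \<infinity> then \<infinity> else ennreal (enn2real a powr r))"

text \<open>
  The Luxemburg norm of the variable exponent space over \<open>E\<close>, as a function of the modulus of its argument. Since
  \<open>\<lambda>\<close> ranges over positive reals, the norm is \<open>\<infinity>\<close> if no \<open>\<lambda>\<close> is admissible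
  (\<^prop>\<open>Inf {} = (\<infinity>::ennreal)\<close>).
\<close>

definition var_norm :: "'a::euclidean_space set \<Rightarrow> ('a \<Rightarrow> real) \<Rightarrow> ('a \<Rightarrow> ennreal) \<Rightarrow> ennreal" where
  "var_norm E r F =
     Inf {ennreal lam |lam. 0 < lam \<and>
            (\<integral>\<^sup>+ z\<in>E. ennpow (F z / ennreal lam) (r z) \<partial>lebesgue) \<le> 1}"

definition intervals_at :: "real \<Rightarrow> real set set" where
  "intervals_at x = {I. x \<in> I \<and> is_interval I \<and> bounded I \<and> 0 < measure lebesgue I}"

definition weight :: "(real \<times> real \<Rightarrow> real) \<Rightarrow> bool" where
  "weight v \<longleftrightarrow> v \<in> borel_measurable lebesgue \<and> (AE z in lebesgue. 0 < v z)"

definition strong_maximal ::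
  "(real \<Rightarrow> real) \<Rightarrow> (real \<Rightarrow> real) \<Rightarrow> (real \<times> real \<Rightarrow> real) \<Rightarrow> real \<times> real \<Rightarrow> ennreal" where
  "strong_maximal \<alpha> \<beta> f = (\<lambda>(x, y).
     (SUP I\<in>intervals_at x. SUP J\<in>intervals_at y.
        ennreal (measure lebesgue I powr (\<alpha> x - 1) * measure lebesgue J powr (\<beta> y - 1))
        * (\<integral>\<^sup>+ z\<in>I \<times> J. ennreal \<bar>f z\<bar> \<partial>lebesgue)))"

text \<open>
  The first and second weight maximal functions are the instances \<open>r = p\<^sub>-\<close> and
  \<open>r = p\<^sub>+\<close> of the same expression. The extrema \<open>g\<^sub>-\<close> and \<open>g\<^sub>+\<close> are written as the
  real-valued \<open>Inf (range g)\<close> and \<open>Sup (range g)\<close>, which are the true extrema of bounded \<open>g\<close>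
  only; the inequalities assumed between the extrema of \<open>p, q, \<alpha>, \<beta>\<close>, read in the extended
  reals, already force boundedness.
\<close>

definition weight_maximal_exp ::
  "real \<Rightarrow> (real \<times> real \<Rightarrow> real) \<Rightarrow> (real \<Rightarrow> real) \<Rightarrow> (real \<Rightarrow> real) \<Rightarrow>
   (real \<times> real \<Rightarrow> real) \<Rightarrow> real \<times> real \<Rightarrow> ennreal" where
  "weight_maximal_exp r q \<alpha> \<beta> v = (\<lambda>(x, y).
     (SUP I\<in>intervals_at x. SUP J\<in>intervals_at y.
        ennreal (measure lebesgue (I \<times> J) powr (- (1 / r)))
        * var_norm (I \<times> J) q
            (\<lambda>(s, t). ennreal \<bar>v (s, t) * measure lebesgue I powr \<alpha> s * measure lebesgue J powr \<beta> t\<bar>)))"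

definition weight_maximal ::
  "(real \<times> real \<Rightarrow> real) \<Rightarrow> (real \<times> real \<Rightarrow> real) \<Rightarrow> (real \<Rightarrow> real) \<Rightarrow> (real \<Rightarrow> real) \<Rightarrow>
   (real \<times> real \<Rightarrow> real) \<Rightarrow> real \<times> real \<Rightarrow> ennreal" where
  "weight_maximal p q \<alpha> \<beta> v z =
     max (weight_maximal_exp (Inf (range p)) q \<alpha> \<beta> v z)
         (weight_maximal_exp (Sup (range p)) q \<alpha> \<beta> v z)"

end

theory Submission
  imports Defs
begin

text \<open>
  The supremum over all rectangles is dominated, up to a constant, by the supremum over the countable
  family of products \<open>R = I \<times> J\<close> of tripled dyadic intervals, and this in turn, after raising to the
  power \<open>q(\<cdot>)\<close>, by the sum over the family. This looks wasteful, but because \<open>p < q\<close> the sum converges.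

  Let \<open>N R\<close> be the norm of \<open>v \<bar>I\<bar>\<^sup>\<alpha> \<bar>J\<bar>\<^sup>\<beta>\<close> in \<open>L\<^sup>q\<^sup>(\<^sup>\<cdot>\<^sup>)(R)\<close>. By the definition of the Luxemburg norm the
  contribution of \<open>R\<close> to the modular is bounded by the power \<open>q\<^sub>-\<close> of a multiple of \<open>N R\<close> times the mean
  of \<open>\<bar>f\<bar>\<close> over \<open>R\<close>, provided that this product is small (\<open>modular_le_var_norm\<close>). By the definition of
  the weight maximal function, \<open>N R\<close> is at most \<open>\<bar>R\<bar>\<^sup>1\<^sup>/\<^sup>r\<close> times its infimum over \<open>R\<close>, for both
  \<open>r = p\<^sub>-\<close> and \<open>r = p\<^sub>+\<close>. Let \<open>g\<close> be \<open>\<bar>f\<bar>\<close> times the weight maximal function, normalized to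
  have modular at most \<open>1\<close>. The part of \<open>g\<close> above \<open>1\<close> is in the unit ball of the constant exponent space with
  exponent \<open>p\<^sub>-\<close>, the part below \<open>1\<close> in that with exponent \<open>p\<^sub>+\<close>, and taking \<open>r = p\<^sub>-\<close> on the first and
  \<open>r = p\<^sub>+\<close> on the second reduces the theorem (in \<open>modular_estimate\<close>) to two instances of a constant exponent
  inequality: for \<open>1 < p < q\<close> and \<open>\<integral> G\<^sup>p \<le> 1\<close>, the sum over all \<open>R\<close> of the \<open>q\<close>-th powers of
  \<open>\<bar>R\<bar>\<^sup>1\<^sup>/\<^sup>p\<^sup>-\<^sup>1 \<integral>\<^sub>R G\<close> is bounded (\<open>rectangle_embedding\<close>).

  That inequality is obtained one variable at a time. In one variable (\<open>dyadic_embedding_vector\<close>),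
  Hoelder's inequality against the weight \<open>max(G, \<bar>I\<bar>\<^sup>-\<^sup>1\<^sup>/\<^sup>p)\<close> reduces the sum to the integral of \<open>G\<^sup>p\<close> times
  a function of \<open>\<bar>I\<bar> G\<^sup>p\<close> that decays geometrically for intervals much longer and much shorter than
  \<open>G\<^sup>-\<^sup>p\<close>, so that summing over scales costs a constant. The argument applies verbatim to a sequence of functions,
  which is what permits the iteration.
\<close>

section \<open>Real powers of extended nonnegative reals\<close>

lemma ennpow_ennreal: "0 \<le> x \<Longrightarrow> ennpow (ennreal x) r = ennreal (x powr r)"
  by (simp add: ennpow_def)

lemma ennpow_top [simp]: "ennpow top r = top"
  by (simp add: ennpow_def)

lemma ennpow_0 [simp]: "ennpow 0 r = 0"
  by (simp add: ennpow_def)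

lemma ennpow_1 [simp]: "ennpow a 1 = a"
  by (cases a) (auto simp: ennpow_def)

lemma ennpow_mono: "a \<le> b \<Longrightarrow> 0 \<le> r \<Longrightarrow> ennpow a r \<le> ennpow b r"
  by (cases a; cases b) (auto simp: ennpow_def powr_mono2 top_unique)

lemma ennpow_ennpow: "ennpow (ennpow a r) s = ennpow a (r * s)"
  by (cases a) (auto simp: ennpow_def powr_powr)

lemma ennpow_eq_0_iff [simp]: "ennpow a r = 0 \<longleftrightarrow> a = 0"
  by (cases a) (auto simp: ennpow_def)

lemma ennpow_mult: "ennpow (a * b) r = ennpow a r * ennpow b r"
proof (cases "a = top \<or> b = top")
  case True
  then show ?thesis
    by (cases "a = 0"; cases "b = 0") (auto simp: ennreal_top_mult ennreal_mult_top)
next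
  case False
  then obtain x y where "a = ennreal x" "0 \<le> x" "b = ennreal y" "0 \<le> y"
    by (metis ennreal_cases)
  then show ?thesis
    by (simp add: ennpow_ennreal powr_mult flip: ennreal_mult)
qed

lemma ennpow_add_le:
  assumes "0 \<le> r"
  shows "ennpow (a + b) r \<le> ennreal (2 powr r) * (ennpow a r + ennpow b r)"
proof -
  have "ennpow (a + b) r \<le> ennpow (2 * max a b) r"
    by (intro ennpow_mono assms) (simp add: add_mono mult_2)
  also have "\<dots> = ennreal (2 powr r) * ennpow (max a b) r"
    by (simp add: ennpow_mult ennpow_ennreal flip: ennreal_numeral)
  also have "\<dots> \<le> ennreal (2 powr r) * (ennpow a r + ennpow b r)"
    by (intro mult_left_mono) (auto simp: max_def add_increasing add_increasing2)
  finally show ?thesis .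
qed

lemma ennpow_antimono_exponent: "a \<le> 1 \<Longrightarrow> 0 < r \<Longrightarrow> r \<le> s \<Longrightarrow> ennpow a s \<le> ennpow a r"
  by (cases a) (auto simp: ennpow_def top_unique powr_mono')

lemma ennpow_mono_exponent: "1 \<le> a \<Longrightarrow> r \<le> s \<Longrightarrow> ennpow a r \<le> ennpow a s"
  by (cases a) (auto simp: ennpow_def powr_mono)

lemma le_of_ennpow_le:
  assumes "1 \<le> r" "0 \<le> C" "ennpow a r \<le> ennreal C"
  shows "a \<le> ennreal (1 + C)"
proof (cases "a \<le> 1")
  case True
  also have "1 \<le> ennreal (1 + C)" using assms by simp
  finally show ?thesis .
next
  case False
  then have "a \<le> ennpow a r" using ennpow_mono_exponent[of a 1 r] assms by simp
  also have "\<dots> \<le> ennreal C" by fact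
  also have "\<dots> \<le> ennreal (1 + C)" by (simp add: ennreal_leI)
  finally show ?thesis .
qed

lemma measurable_ennpow [measurable]:
  assumes [measurable]: "f \<in> borel_measurable M" "r \<in> borel_measurable M"
  shows "(\<lambda>x. ennpow (f x) (r x)) \<in> borel_measurable M"
  unfolding ennpow_def by measurable

text \<open>
  Every term is at most the \<open>r\<close>-th root of the sum. Replacing the supremum by a sum is what makes the
  maximal function accessible to termwise integration.
\<close>

lemma ennpow_le_sum:
  assumes r: "0 < r" and le: "a \<le> (SUP i. F i)"
  shows "ennpow a r \<le> (\<integral>\<^sup>+i. ennpow (F i) r \<partial>count_space UNIV)" (is "_ \<le> ?T")
proof -
  have "F i \<le> ennpow ?T (1 / r)" for i
  proof -
    have "ennpow (ennpow (F i) r) (1 / r) \<le> ennpow ?T (1 / r)"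
      using r by (intro ennpow_mono nn_integral_ge_point) auto
    then show ?thesis
      using r by (simp add: ennpow_ennpow)
  qed
  then have "a \<le> ennpow ?T (1 / r)"
    using le by (meson SUP_least order_trans)
  then have "ennpow a r \<le> ennpow (ennpow ?T (1 / r)) r"
    using r by (intro ennpow_mono) auto
  then show ?thesis
    using r by (simp add: ennpow_ennpow)
qed

section \<open>Modulars and Luxemburg norms\<close>

text \<open>
  Covers the degenerate case in which the norm in a modular estimate vanishes.
\<close>

lemma eq_0_if_le_all_powr:
  assumes r: "0 < r" and le: "\<And>t. 0 < t \<Longrightarrow> t \<le> 1 \<Longrightarrow> X \<le> ennreal (t powr r)"
  shows "X = 0"
proof -
  have "X \<le> 0 + ennreal e" if e: "0 < e" for e
  proof -
    define t where "t = min 1 (e powr (1 / r))"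
    have t: "0 < t" "t \<le> 1" using e by (auto simp: t_def)
    have "t powr r \<le> (e powr (1 / r)) powr r"
      using r e by (intro powr_mono2) (auto simp: t_def)
    then have "ennreal (t powr r) \<le> 0 + ennreal e"
      using r e by (simp add: powr_powr ennreal_leI)
    with le[OF t] show ?thesis by (rule order_trans)
  qed
  then have "X \<le> 0"
    by (rule ennreal_le_epsilon)
  then show ?thesis by simp
qed

text \<open>
  If \<open>l\<close> is admissible for the norm and \<open>l a \<le> t \<le> 1\<close>, then \<open>F a = (F / l) (l a)\<close> gains a factor
  \<open>(l a)\<^sup>r \<le> t\<^sup>r\<close>, which is at most \<open>t\<close> to the power \<open>r0\<close>. The factor \<open>a\<close> may be infinite: the
  hypothesis then forces the norm, and so \<open>F\<close> almost everywhere on \<open>E\<close>, to be zero.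
\<close>

lemma modular_less_var_norm:
  fixes F :: "'a::euclidean_space \<Rightarrow> ennreal"
  assumes r0: "0 < r0" "\<And>z. r0 \<le> r z"
    and [measurable]: "F \<in> borel_measurable lebesgue" "r \<in> borel_measurable lebesgue" "E \<in> sets lebesgue"
    and t: "0 < t" "t \<le> 1"
    and less: "var_norm E r F * a < ennreal t"
  shows "(\<integral>\<^sup>+z\<in>E. ennpow (F z * a) (r z) \<partial>lebesgue) \<le> ennreal (t powr r0)"
proof -
  have fin: "(\<integral>\<^sup>+z\<in>E. ennpow (F z * ennreal b) (r z) \<partial>lebesgue) \<le> ennreal (t powr r0)"
    if b: "0 < b" and less: "var_norm E r F * ennreal b < ennreal t" and t: "0 < t" "t \<le> 1" for b t
  proof -
    have "var_norm E r F < ennreal (t / b)"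
    proof (rule ccontr)
      assume "\<not> ?thesis"
      then have "ennreal (t / b) * ennreal b \<le> var_norm E r F * ennreal b"
        by (intro mult_right_mono) auto
      with less b t show False
        by (simp flip: ennreal_mult)
    qed
    then obtain l where l: "0 < l" "ennreal l < ennreal (t / b)"
      and int: "(\<integral>\<^sup>+z\<in>E. ennpow (F z / ennreal l) (r z) \<partial>lebesgue) \<le> 1"
      unfolding var_norm_def Inf_less_iff by auto
    have lb: "l * b \<le> t"
      using l b t by (simp add: ennreal_less_iff field_simps)
    have "ennpow (F z * ennreal b) (r z) \<le> ennreal (t powr r0) * ennpow (F z / ennreal l) (r z)" for z
    proof -
      have "inverse (ennreal l) * ennreal (l * b) = ennreal b"
        using l b by (simp add: inverse_ennreal flip: ennreal_mult)
      then have "F z * ennreal b = F z / ennreal l * ennreal (l * b)"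
        by (simp add: divide_ennreal_def mult.assoc)
      also have "ennpow \<dots> (r z) = ennpow (F z / ennreal l) (r z) * ennreal ((l * b) powr r z)"
        using l b by (simp add: ennpow_mult ennpow_ennreal)
      also have "ennpow (F z / ennreal l) (r z) * ennreal ((l * b) powr r z)
          \<le> ennpow (F z / ennreal l) (r z) * ennreal (t powr r0)"
      proof (intro mult_left_mono ennreal_leI)
        have "(l * b) powr r z \<le> t powr r z"
          using lb l b r0(1) r0(2)[of z] by (intro powr_mono2) auto
        also have "\<dots> \<le> t powr r0"
          using t r0(2)[of z] by (intro powr_mono') auto
        finally show "(l * b) powr r z \<le> t powr r0" .
      qed simp
      finally show ?thesis by (simp only: mult.commute)
    qed
    then have "(\<integral>\<^sup>+z\<in>E. ennpow (F z * ennreal b) (r z) \<partial>lebesgue)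
       \<le> (\<integral>\<^sup>+z. ennreal (t powr r0) * (ennpow (F z / ennreal l) (r z) * indicator E z) \<partial>lebesgue)"
      by (intro nn_integral_mono) (auto split: split_indicator)
    also have "\<dots> = ennreal (t powr r0) * (\<integral>\<^sup>+z\<in>E. ennpow (F z / ennreal l) (r z) \<partial>lebesgue)"
      by (rule nn_integral_cmult) measurable
    also have "\<dots> \<le> ennreal (t powr r0) * 1"
      by (intro mult_left_mono int) auto
    finally show ?thesis by simp
  qed
  show ?thesis
  proof (cases a)
    case (real b)
    then show ?thesis
      using fin[of b t] less t by (cases "b = 0") auto
  next
    case top
    then have 0: "var_norm E r F = 0"
      using less by (simp add: ennreal_mult_top split: if_splits)
    have "(\<integral>\<^sup>+z\<in>E. ennpow (F z) (r z) \<partial>lebesgue) = 0"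
      using fin[of 1] 0 by (intro eq_0_if_le_all_powr[OF r0(1)]) auto
    then have "AE z in lebesgue. ennpow (F z) (r z) * indicator E z = 0"
      by (simp add: nn_integral_0_iff_AE)
    then have "AE z in lebesgue. ennpow (F z * a) (r z) * indicator E z = 0"
      by (rule eventually_mono) auto
    then have "(\<integral>\<^sup>+z\<in>E. ennpow (F z * a) (r z) \<partial>lebesgue) = 0"
      by (simp add: nn_integral_0_iff_AE)
    then show ?thesis by simp
  qed
qed

text \<open>
  The factor \<open>2\<close> leaves room for an admissible \<open>l\<close> above the norm, so that it need not be shown
  that the infimum defining the norm is attained.
\<close>

lemma modular_le_var_norm:
  fixes F :: "'a::euclidean_space \<Rightarrow> ennreal"
  assumes r0: "0 < r0" "\<And>z. r0 \<le> r z"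
    and meas: "F \<in> borel_measurable lebesgue" "r \<in> borel_measurable lebesgue" "E \<in> sets lebesgue"
    and le: "var_norm E r F * a \<le> T" and T: "2 * T \<le> 1"
  shows "(\<integral>\<^sup>+z\<in>E. ennpow (F z * a) (r z) \<partial>lebesgue) \<le> ennpow (2 * T) r0"
proof -
  have "T \<noteq> top"
    using T by (auto simp: ennreal_mult_top top_unique)
  then obtain s where s: "T = ennreal s" "0 \<le> s" by (metis ennreal_cases)
  have 2: "2 * T = ennreal (2 * s)" using s by (simp add: ennreal_mult flip: ennreal_numeral)
  with T s have s1: "2 * s \<le> 1" by (simp add: ennreal_le_1)
  show ?thesis
  proof (cases "s = 0")
    case False
    with s have "T < ennreal (2 * s)"
      by (simp add: ennreal_less_iff)
    with le have "var_norm E r F * a < ennreal (2 * s)" by (rule le_less_trans)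
    then have "(\<integral>\<^sup>+z\<in>E. ennpow (F z * a) (r z) \<partial>lebesgue) \<le> ennreal ((2 * s) powr r0)"
      using r0 meas False s s1 by (intro modular_less_var_norm) auto
    then show ?thesis
      unfolding 2 using s by (subst ennpow_ennreal) auto
  next
    case True
    have "(\<integral>\<^sup>+z\<in>E. ennpow (F z * a) (r z) \<partial>lebesgue) \<le> ennreal (t powr r0)"
      if t: "0 < t" "t \<le> 1" for t
    proof (rule modular_less_var_norm)
      show "var_norm E r F * a < ennreal t"
        by (rule le_less_trans[OF le]) (simp add: s True t)
    qed (use r0 meas t in auto)
    then have "(\<integral>\<^sup>+z\<in>E. ennpow (F z * a) (r z) \<partial>lebesgue) = 0"
      by (rule eq_0_if_le_all_powr[OF r0(1)])
    then show ?thesis by simp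
  qed
qed

text \<open>
  Homogeneity: a modular bound at level \<open>1\<close>, valid at every scale, is a norm inequality.
\<close>

lemma var_norm_le_of_modular:
  assumes c: "0 < c"
    and "\<And>l. 0 < l \<Longrightarrow> (\<integral>\<^sup>+z\<in>E. ennpow (G z / ennreal l) (p z) \<partial>lebesgue) \<le> 1 \<Longrightarrow>
      (\<integral>\<^sup>+z\<in>E. ennpow (F z / ennreal (c * l)) (q z) \<partial>lebesgue) \<le> 1"
  shows "var_norm E q F \<le> ennreal c * var_norm E p G"
proof -
  have "var_norm E q F / ennreal c \<le> var_norm E p G"
    unfolding var_norm_def[of E p G]
  proof (rule Inf_greatest, safe)
    fix l :: real assume l: "0 < l" "(\<integral>\<^sup>+z\<in>E. ennpow (G z / ennreal l) (p z) \<partial>lebesgue) \<le> 1"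
    then have "var_norm E q F \<le> ennreal (c * l)"
      unfolding var_norm_def using assms by (intro Inf_lower) (auto intro!: exI[of _ "c * l"])
    then show "var_norm E q F / ennreal c \<le> ennreal l"
      using c l by (intro divide_le_posI_ennreal) (auto simp: ennreal_mult mult.commute)
  qed
  then have "ennreal c * (var_norm E q F / ennreal c) \<le> ennreal c * var_norm E p G"
    by (rule mult_left_mono) simp
  then show ?thesis
    using c by (simp add: ennreal_times_divide ennreal_mult_divide_eq mult.commute[of "ennreal c"])
qed

section \<open>Tripled dyadic intervals\<close>

text \<open>
  \<open>tripled_dyadic (k, n)\<close> is the dyadic interval with corner \<open>n\<close> at scale \<open>2\<^sup>k\<close> together with its two
  neighbours. Tripling makes every interval lie in a member of comparable length; the members of
  one scale have bounded overlap, and the family stays countable.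
\<close>

definition tripled_length :: "int \<times> int \<Rightarrow> real" where
  "tripled_length J = 3 * 2 powr real_of_int (fst J)"

definition tripled_dyadic :: "int \<times> int \<Rightarrow> real set" where
  "tripled_dyadic J =
     {(real_of_int (snd J) - 1) * 2 powr real_of_int (fst J) ..<
      (real_of_int (snd J) + 2) * 2 powr real_of_int (fst J)}"

lemma tripled_length_pos [simp]: "0 < tripled_length J"
  by (simp add: tripled_length_def)

lemma tripled_dyadic_sets [measurable]: "tripled_dyadic J \<in> sets borel"
  by (simp add: tripled_dyadic_def)

lemma emeasure_tripled_dyadic: "emeasure lborel (tripled_dyadic J) = ennreal (tripled_length J)"
  by (simp add: tripled_dyadic_def tripled_length_def algebra_simps flip: mult.assoc)

lemma measure_tripled_dyadic: "measure lebesgue (tripled_dyadic J) = tripled_length J"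
  by (simp add: measure_def emeasure_tripled_dyadic less_imp_le)

lemma tripled_dyadic_in_intervals_at: "x \<in> tripled_dyadic J \<Longrightarrow> tripled_dyadic J \<in> intervals_at x"
  by (simp add: intervals_at_def measure_tripled_dyadic) (simp add: tripled_dyadic_def is_interval_cc)

text \<open>
  At one scale the tripled intervals cover each point exactly three times; an upper bound is enough
  to sum their integrals.
\<close>

lemma tripled_dyadic_overlap:
  "(\<integral>\<^sup>+n. indicator (tripled_dyadic (k, n)) x \<partial>count_space UNIV) \<le> (3 :: ennreal)"
proof -
  let ?m = "\<lfloor>x / 2 powr real_of_int k\<rfloor>"
  have "{n. x \<in> tripled_dyadic (k, n)} \<subseteq> {?m - 1, ?m, ?m + 1}" (is "?A \<subseteq> ?B")
  proof
    fix n assume "n \<in> ?A"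
    then have "real_of_int n - 1 \<le> x / 2 powr real_of_int k" "x / 2 powr real_of_int k < real_of_int n + 2"
      by (auto simp: tripled_dyadic_def field_simps)
    then have "n - 1 \<le> ?m" "?m < n + 2"
      by linarith+
    then show "n \<in> ?B" by auto
  qed
  then have "emeasure (count_space UNIV) ?A \<le> emeasure (count_space UNIV) ?B"
    by (intro emeasure_mono) auto
  also have "\<dots> \<le> 3" by simp
  finally have "(\<integral>\<^sup>+n. indicator ?A n \<partial>count_space UNIV) \<le> (3::ennreal)"
    by (subst nn_integral_indicator) auto
  then show ?thesis
    by (simp add: indicator_def)
qed

text \<open>
  With \<open>2\<^sup>k\<^sup>-\<^sup>1 < \<bar>I\<bar> \<le> 2\<^sup>k\<close> and \<open>n\<close> the index of the dyadic interval at scale \<open>2\<^sup>k\<close> containing \<open>x\<close>, no point of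
  \<open>I\<close> is further than \<open>2\<^sup>k\<close> from \<open>x\<close>.
\<close>

lemma interval_subset_tripled_dyadic:
  assumes I: "I \<in> intervals_at x"
  obtains J where "I \<subseteq> tripled_dyadic J" "tripled_length J \<le> 6 * measure lebesgue I"
proof -
  define L where "L = measure lebesgue I"
  have L: "0 < L" and x: "x \<in> I" and int: "is_interval I" and bdd: "bounded I"
    using I by (auto simp: intervals_at_def L_def)
  have lm: "I \<in> lmeasurable"
    using int bdd by (intro measurable_convex is_interval_convex)
  have dist: "\<bar>y - x\<bar> \<le> L" if y: "y \<in> I" for y
  proof -
    have "{min x y..max x y} \<subseteq> I"
    proof
      fix z assume "z \<in> {min x y..max x y}"
      moreover have "min x y \<in> I" "max x y \<in> I"
        using x y by (simp_all add: min_def max_def)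
      ultimately show "z \<in> I"
        using int[unfolded is_interval_1] by (meson atLeastAtMost_iff)
    qed
    then have "measure lebesgue {min x y..max x y} \<le> L"
      unfolding L_def using lm by (intro measure_mono_fmeasurable) auto
    then show ?thesis by (auto simp: min_def max_def split: if_splits)
  qed
  define k where "k = \<lceil>log 2 L\<rceil>"
  define T where "T = 2 powr real_of_int k"
  define n where "n = \<lfloor>x / T\<rfloor>"
  have "log 2 L \<le> real_of_int k" "real_of_int k - 1 < log 2 L"
    unfolding k_def by linarith+
  then have LT: "L \<le> T" "2 powr (real_of_int k - 1) < L"
    using L unfolding T_def by (simp_all add: log_le_iff less_log_iff)
  then have T2: "T < 2 * L"
    by (simp add: T_def powr_diff)
  have T: "0 < T" by (simp add: T_def)
  have "real_of_int n \<le> x / T" "x / T < real_of_int n + 1"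
    unfolding n_def by linarith+
  then have n: "real_of_int n * T \<le> x" "x < (real_of_int n + 1) * T"
    using T by (simp_all add: field_simps)
  have "I \<subseteq> tripled_dyadic (k, n)"
  proof
    fix y assume "y \<in> I"
    then have "x - T \<le> y" "y \<le> x + T" using dist[of y] LT by linarith+
    with n have "(real_of_int n - 1) * T \<le> y" "y < (real_of_int n + 2) * T"
      by (auto simp: algebra_simps)
    then show "y \<in> tripled_dyadic (k, n)"
      by (simp add: tripled_dyadic_def T_def)
  qed
  moreover have "tripled_length (k, n) \<le> 6 * measure lebesgue I"
    using T2 by (simp add: tripled_length_def T_def L_def)
  ultimately show thesis by (rule that)
qed

section \<open>The embedding over dyadic intervals\<close>

lemma nn_integral_count_space_int:
  fixes F :: "int \<Rightarrow> ennreal"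
  shows "(\<integral>\<^sup>+j. F j \<partial>count_space UNIV) = (\<Sum>i. F (int i)) + (\<Sum>i. F (- int i - 1))"
proof -
  have "(\<integral>\<^sup>+j. F j \<partial>count_space UNIV)
    = (\<integral>\<^sup>+j. F j * indicator {0..} j + F j * indicator {..<0} j \<partial>count_space UNIV)"
    by (intro nn_integral_cong) (auto split: split_indicator)
  also have "\<dots> = (\<integral>\<^sup>+j. F j * indicator {0..} j \<partial>count_space UNIV)
      + (\<integral>\<^sup>+j. F j * indicator {..<0} j \<partial>count_space UNIV)"
    by (intro nn_integral_add) auto
  also have "\<dots> = (\<integral>\<^sup>+j. F j \<partial>count_space {0..}) + (\<integral>\<^sup>+j. F j \<partial>count_space {..<0})"
    by (simp add: nn_integral_count_space_indicator)
  also have "(\<integral>\<^sup>+j. F j \<partial>count_space {0..}) = (\<integral>\<^sup>+i. F (int i) \<partial>count_space UNIV)"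
    by (intro nn_integral_bij_count_space[symmetric] bij_betwI[of _ _ _ nat]) auto
  also have "(\<integral>\<^sup>+j. F j \<partial>count_space {..<0}) = (\<integral>\<^sup>+i. F (- int i - 1) \<partial>count_space UNIV)"
    by (intro nn_integral_bij_count_space[symmetric] bij_betwI[of _ _ _ "\<lambda>j. nat (- j - 1)"]) auto
  finally show ?thesis
    by (simp add: nn_integral_count_space_nat)
qed

text \<open>
  The minimum decays geometrically in both directions away from the scale \<open>2\<^sup>k \<sim> 1 / s\<close>. The bound is
  uniform in \<open>s\<close> because multiplying \<open>s\<close> by a power of two only shifts the summation index.
\<close>

lemma dyadic_kernel_sum:
  assumes a: "0 < a" and b: "0 < b"
  obtains C :: real where "0 < C"
    and "\<And>s. 0 < s \<Longrightarrow>
      (\<integral>\<^sup>+k. ennreal (min ((2 powr real_of_int k * s) powr (- a)) ((2 powr real_of_int k * s) powr b))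
         \<partial>count_space UNIV) \<le> ennreal C"
proof
  define ra rb where "ra = (2::real) powr (- a)" and "rb = (2::real) powr (- b)"
  have ra: "0 < ra" "ra < 1" and rb: "0 < rb" "rb < 1"
    using a b by (auto simp: ra_def rb_def powr_less_one)
  let ?C = "1 / (1 - ra) + 1 / (1 - rb)"
  show "0 < ?C" using ra rb by (intro add_pos_pos) auto
  fix s :: real assume s: "0 < s"
  define h where "h u = min (u powr (- a)) (u powr b)" for u :: real
  define m where "m = \<lfloor>log 2 s\<rfloor>"
  have m: "2 powr real_of_int m \<le> s" "s < 2 powr (real_of_int m + 1)"
    using s unfolding m_def by (auto simp: powr_le_iff less_powr_iff le_log_iff)
  have "(\<integral>\<^sup>+k. ennreal (h (2 powr real_of_int k * s)) \<partial>count_space UNIV)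
      = (\<integral>\<^sup>+j. ennreal (h (2 powr real_of_int (j - m) * s)) \<partial>count_space UNIV)"
    by (intro nn_integral_bij_count_space[symmetric] bij_betwI[of _ _ _ "\<lambda>j. j + m"]) auto
  also have "\<dots> = (\<Sum>i. ennreal (h (2 powr real_of_int (int i - m) * s)))
       + (\<Sum>i. ennreal (h (2 powr real_of_int (- int i - 1 - m) * s)))"
    by (rule nn_integral_count_space_int)
  also have "\<dots> \<le> (\<Sum>i. ennreal (ra ^ i)) + (\<Sum>i. ennreal (rb ^ i))"
  proof (intro add_mono suminf_le ennreal_leI)
    fix i :: nat
    have "2 powr real i = 2 powr real_of_int (int i - m) * 2 powr real_of_int m"
      by (simp flip: powr_add)
    also have "\<dots> \<le> 2 powr real_of_int (int i - m) * s"
      using m by (intro mult_left_mono) auto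
    finally have "h (2 powr real_of_int (int i - m) * s) \<le> (2 powr real i) powr (- a)"
      unfolding h_def using a by (intro min.coboundedI1 powr_mono2') auto
    also have "\<dots> = ra ^ i"
      by (simp add: ra_def powr_powr mult.commute flip: powr_realpow)
    finally show "h (2 powr real_of_int (int i - m) * s) \<le> ra ^ i" .
  next
    fix i :: nat
    have "2 powr real_of_int (- int i - 1 - m) * s
        \<le> 2 powr real_of_int (- int i - 1 - m) * 2 powr (real_of_int m + 1)"
      using m by (intro mult_left_mono) auto
    also have "\<dots> = 2 powr (- real i)"
      by (simp flip: powr_add)
    finally have "h (2 powr real_of_int (- int i - 1 - m) * s) \<le> (2 powr (- real i)) powr b"
      unfolding h_def using b s by (intro min.coboundedI2 powr_mono2) auto
    also have "\<dots> = rb ^ i"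
      by (simp add: rb_def powr_powr mult.commute flip: powr_realpow)
    finally show "h (2 powr real_of_int (- int i - 1 - m) * s) \<le> rb ^ i" .
  qed auto
  also have "\<dots> = ennreal (1 / (1 - ra)) + ennreal (1 / (1 - rb))"
    using ra rb by (simp add: suminf_ennreal2 suminf_geometric summable_geometric)
  also have "\<dots> = ennreal ?C"
    using ra rb by (simp flip: ennreal_plus)
  finally show "(\<integral>\<^sup>+k. ennreal (min ((2 powr real_of_int k * s) powr (- a)) ((2 powr real_of_int k * s) powr b))
         \<partial>count_space UNIV) \<le> ennreal ?C"
    by (simp add: h_def)
qed

text \<open>
  The contribution of one interval length \<open>L\<close> at a point where the density is \<open>d\<close>, as a function of
  \<open>s = L d\<close>. Scales with \<open>s \<ge> 1\<close> are controlled by the first term, those with \<open>s \<le> 1\<close> by the second;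
  the second exponent is positive exactly because \<open>p < q\<close>.
\<close>

definition dyadic_kernel :: "real \<Rightarrow> real \<Rightarrow> real \<Rightarrow> real" where
  "dyadic_kernel p q s = min (s powr (- (1 - 1 / p))) (s powr (q / p - 1))"

lemma dyadic_kernel_measurable [measurable]: "dyadic_kernel p q \<in> borel_measurable borel"
  unfolding dyadic_kernel_def by measurable

text \<open>
  Both sides are in fact equal: the two branches of the maximum on the left produce the two branches of
  the kernel. Logarithmic coordinates \<open>L = e\<^sup>x\<close>, \<open>d = e\<^sup>y\<close> turn this into a linear identity.
\<close>

lemma dyadic_kernel_bound:
  assumes p: "1 < p" "p < q" and L: "0 < L" and d: "0 \<le> d"
  shows "L powr (- (1 - 1 / p)) * (d powr (q / p) * (max d (1 / L) powr (1 / p)) powr (1 - q))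
    \<le> d * dyadic_kernel p q (L * d)"
proof (cases "d = 0")
  case True
  then show ?thesis by simp
next
  case False
  with d have d: "0 < d" by simp
  define x y where "x = ln L" and "y = ln d"
  have Lx: "L = exp x" and dy: "d = exp y" using L d by (auto simp: x_def y_def)
  have max: "max d (1 / L) = exp (max y (- x))"
    by (auto simp: Lx dy max_def exp_minus field_simps simp flip: exp_add)
  have "L powr (- (1 - 1 / p)) * (d powr (q / p) * (max d (1 / L) powr (1 / p)) powr (1 - q))
     = exp (- (1 - 1 / p) * x + (q / p * y + (1 / p) * (1 - q) * max y (- x)))"
    unfolding max powr_powr unfolding Lx dy powr_def
    by (simp add: algebra_simps add_divide_distrib diff_divide_distrib flip: exp_add)
  also have "\<dots> \<le> exp (y + min (- (1 - 1 / p) * (x + y)) ((q / p - 1) * (x + y)))"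
  proof -
    have r: "0 \<le> 1 - 1 / p" "0 \<le> q / p - 1" using p by auto
    show ?thesis
    proof (cases "0 \<le> x + y")
      case True
      then have "- (1 - 1 / p) * (x + y) \<le> (q / p - 1) * (x + y)"
        using r by (intro mult_right_mono) auto
      then have *: "min (- (1 - 1 / p) * (x + y)) ((q / p - 1) * (x + y)) = - (1 - 1 / p) * (x + y)"
        by (rule min_absorb1)
      have **: "max y (- x) = y" using True by simp
      show ?thesis unfolding * ** using p by (simp add: field_simps)
    next
      case False
      then have "(q / p - 1) * (x + y) \<le> - (1 - 1 / p) * (x + y)"
        using r by (intro mult_right_mono_neg) auto
      then have *: "min (- (1 - 1 / p) * (x + y)) ((q / p - 1) * (x + y)) = (q / p - 1) * (x + y)"
        by (rule min_absorb2)
      have **: "max y (- x) = - x" using False by simp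
      show ?thesis unfolding * ** using p by (simp add: field_simps)
    qed
  qed
  also have "\<dots> = d * dyadic_kernel p q (L * d)"
    by (auto simp: dyadic_kernel_def Lx dy powr_def min_def algebra_simps simp flip: exp_add)
  finally show ?thesis .
qed

text \<open>
  Hoelder's inequality for \<open>A = (A / w) w\<close> with respect to the measure \<open>w dM\<close>, up to the constant
  \<open>2\<^sup>q\<close>. With \<open>u = A / w\<close> and any level \<open>t > 0\<close> one has \<open>u \<le> t\<^sup>1\<^sup>-\<^sup>q u\<^sup>q + t\<close>; integrate and choose the \<open>t\<close> that
  balances the two terms.
\<close>

lemma Holder_with_density:
  fixes A :: "'a \<Rightarrow> ennreal" and w :: "'a \<Rightarrow> real"
  assumes q: "1 < q" and W: "0 < W" and w: "\<And>x. 0 < w x"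
    and [measurable]: "A \<in> borel_measurable M" "w \<in> borel_measurable M" "E \<in> sets M"
    and le: "(\<integral>\<^sup>+x\<in>E. ennreal (w x) \<partial>M) \<le> ennreal W"
  shows "ennpow (\<integral>\<^sup>+x\<in>E. A x \<partial>M) q
    \<le> ennreal (2 powr q * W powr (q - 1)) * (\<integral>\<^sup>+x\<in>E. ennpow (A x) q * ennreal (w x powr (1 - q)) \<partial>M)"
    (is "_ \<le> _ * ?S")
proof -
  have pointwise: "A x \<le> ennreal (t powr (1 - q)) * (ennpow (A x) q * ennreal (w x powr (1 - q)))
      + ennreal t * ennreal (w x)" if t: "0 < t" for x t
  proof (cases "A x")
    case (real a)
    show ?thesis
    proof (cases "a \<le> t * w x")
      case True
      then show ?thesis
        using t w[of x] real
        by (intro add_increasing) (auto simp flip: ennreal_mult)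
    next
      case False
      have "0 < t * w x" using t w[of x] by simp
      with False have a: "0 < a" by linarith
      have "a = a powr q * a powr (1 - q)"
        using a by (simp flip: powr_add)
      also have "\<dots> \<le> a powr q * (t * w x) powr (1 - q)"
        using False t w[of x] q by (intro mult_left_mono powr_mono2') auto
      also have "\<dots> = t powr (1 - q) * (a powr q * w x powr (1 - q))"
        using t w[of x] by (simp add: powr_mult)
      finally have "ennreal a \<le> ennreal (t powr (1 - q) * (a powr q * w x powr (1 - q)))"
        by (rule ennreal_leI)
      then show ?thesis
        using real by (intro add_increasing2) (auto simp: ennpow_ennreal ennreal_mult')
    qed
  next
    case top
    then show ?thesis using t w[of x] by (simp add: ennreal_top_mult ennreal_mult_top)
  qed
  have split: "(\<integral>\<^sup>+x\<in>E. A x \<partial>M) \<le> ennreal (t powr (1 - q)) * ?S + ennreal t * ennreal W"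
    if t: "0 < t" for t
  proof -
    have "(\<integral>\<^sup>+x\<in>E. A x \<partial>M)
      \<le> (\<integral>\<^sup>+x. ennreal (t powr (1 - q)) * (ennpow (A x) q * ennreal (w x powr (1 - q)) * indicator E x)
          + ennreal t * (ennreal (w x) * indicator E x) \<partial>M)"
      using pointwise[OF t] by (intro nn_integral_mono) (auto split: split_indicator)
    also have "\<dots> = ennreal (t powr (1 - q)) * ?S + ennreal t * (\<integral>\<^sup>+x\<in>E. ennreal (w x) \<partial>M)"
      by (simp add: nn_integral_add nn_integral_cmult)
    also have "\<dots> \<le> ennreal (t powr (1 - q)) * ?S + ennreal t * ennreal W"
      by (intro add_left_mono mult_left_mono le) auto
    finally show ?thesis .
  qed
  show ?thesis
  proof (cases "?S")
    case (real s)
    show ?thesis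
    proof (cases "s = 0")
      case True
      then have S0: "?S = 0" using real by simp
      then have "AE x in M. ennpow (A x) q * ennreal (w x powr (1 - q)) * indicator E x = 0"
        by (subst (asm) nn_integral_0_iff_AE) auto
      then have "AE x in M. A x * indicator E x = 0"
        using w by (auto elim!: eventually_mono simp: order_less_imp_not_eq2 split: split_indicator_asm)
      then have "(\<integral>\<^sup>+x\<in>E. A x \<partial>M) = 0"
        by (subst nn_integral_0_iff_AE) auto
      then show ?thesis by simp
    next
      case False
      with real have s: "0 < s" by simp
      \<comment> \<open>The level at which both terms of the bound equal \<open>t W\<close>.\<close>
      define t where "t = (s / W) powr (1 / q)"
      have t: "0 < t" using s W by (simp add: t_def)
      have tq: "t powr q = s / W" using s W q by (simp add: t_def powr_powr)
      have "t powr (1 - q) * s = t * W"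
        using t tq s W by (simp add: powr_diff)
      then have "(\<integral>\<^sup>+x\<in>E. A x \<partial>M) \<le> ennreal (2 * (t * W))"
        using split[OF t] real t W s
        by (simp add: mult.commute[of W t] flip: ennreal_mult ennreal_plus)
      then have "ennpow (\<integral>\<^sup>+x\<in>E. A x \<partial>M) q \<le> ennpow (ennreal (2 * (t * W))) q"
        using q by (intro ennpow_mono) auto
      also have "\<dots> = ennreal ((2 * (t * W)) powr q)"
        using t W by (simp add: ennpow_ennreal)
      also have "(2 * (t * W)) powr q = 2 powr q * (t powr q * W powr q)"
        using t W by (simp add: powr_mult)
      also have "\<dots> = 2 powr q * W powr (q - 1) * s"
        using W by (simp add: tq powr_diff)
      finally show ?thesis
        using real by (simp add: ennreal_mult')
    qed
  next
    case top
    then show ?thesis using W by (simp add: ennreal_mult_top)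
  qed
qed

text \<open>
  The weight \<open>w = max(D, 1/L)\<^sup>1\<^sup>/\<^sup>p\<close> makes this work. Its integral over \<open>E\<close> is at most \<open>2 L\<^sup>1\<^sup>-\<^sup>1\<^sup>/\<^sup>p\<close>, since the part
  where \<open>D \<ge> 1/L\<close> satisfies \<open>D\<^sup>1\<^sup>/\<^sup>p \<le> D L\<^sup>1\<^sup>-\<^sup>1\<^sup>/\<^sup>p\<close>. As \<open>w\<close> does not depend on \<open>i\<close>, the Hoelder step can be summed over
  \<open>i\<close> under the integral, where only the pointwise bound on the sum of the \<open>A\<^sub>i\<^sup>q\<close> enters. This vector form
  takes the place of Minkowski's inequality when the embedding is iterated over two variables.
\<close>

lemma interval_estimate:
  fixes A :: "'i::countable \<Rightarrow> 'a \<Rightarrow> ennreal"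
  assumes p: "1 < p" "p < q" and L: "0 < L"
    and [measurable]: "E \<in> sets M" "\<And>i. A i \<in> borel_measurable M" "D \<in> borel_measurable M"
    and E: "emeasure M E = ennreal L"
    and le: "AE x in M. (\<integral>\<^sup>+i. ennpow (A i x) q \<partial>count_space UNIV) \<le> K * ennpow (D x) (q / p)"
    and D: "(\<integral>\<^sup>+x. D x \<partial>M) \<le> 1"
  shows "(\<integral>\<^sup>+i. ennpow (ennreal (L powr (- (1 - 1 / p))) * (\<integral>\<^sup>+x\<in>E. A i x \<partial>M)) q \<partial>count_space UNIV)
    \<le> ennreal (2 powr q * 2 powr (q - 1)) * K * (\<integral>\<^sup>+x\<in>E. D x * ennreal (dyadic_kernel p q (L * enn2real (D x))) \<partial>M)"
proof -
  define d where "d x = enn2real (D x)" for x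
  define w where "w x = max (d x) (1 / L) powr (1 / p)" for x
  define e where "e = 1 - 1 / p"
  define W where "W = 2 * L powr e"
  have [measurable]: "d \<in> borel_measurable M" "w \<in> borel_measurable M"
    unfolding d_def w_def by measurable
  have d: "0 \<le> d x" for x by (simp add: d_def)
  have m: "0 < max (d x) (1 / L)" for x using L by (simp add: less_max_iff_disj)
  have w: "0 < w x" for x using m[of x] by (simp add: w_def)
  have e: "0 < e" using p by (simp add: e_def)
  have W: "0 < W" using L by (simp add: W_def)
  have "AE x in M. D x \<noteq> \<infinity>"
    using D by (intro nn_integral_noteq_infinite) (auto simp: top_unique)
  then have Dd: "AE x in M. D x = ennreal (d x)"
    by (auto elim!: eventually_mono simp: d_def less_top)
  have w_le: "w x \<le> L powr (- (1 / p)) + L powr e * d x" for x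
  proof (cases "d x \<le> 1 / L")
    case True
    have "(1 / L) powr (1 / p) = L powr (- (1 / p))"
      using L by (simp add: powr_divide powr_minus_divide)
    with True show ?thesis
      using d[of x] by (simp add: w_def max_absorb2)
  next
    case False
    then have dx: "0 < d x" using L by (smt (verit) divide_pos_pos)
    have "w x = d x * d x powr (- e)"
      using False dx by (simp add: w_def e_def powr_mult_base)
    also have "\<dots> \<le> d x * (1 / L) powr (- e)"
      using False L dx e by (intro mult_left_mono powr_mono2') auto
    also have "(1 / L) powr (- e) = L powr e"
      using L by (simp add: powr_divide powr_minus)
    finally show ?thesis by (simp add: mult.commute add_increasing)
  qed
  have "(\<integral>\<^sup>+x\<in>E. ennreal (w x) \<partial>M)
     \<le> (\<integral>\<^sup>+x. ennreal (L powr (- (1 / p))) * indicator E x + ennreal (L powr e) * ennreal (d x) \<partial>M)"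
    using w_le d by (intro nn_integral_mono)
      (auto split: split_indicator simp flip: ennreal_mult ennreal_plus intro!: ennreal_leI)
  also have "\<dots> = ennreal (L powr (- (1 / p))) * ennreal L + ennreal (L powr e) * (\<integral>\<^sup>+x. ennreal (d x) \<partial>M)"
    by (simp add: nn_integral_add nn_integral_cmult E)
  also have "(\<integral>\<^sup>+x. ennreal (d x) \<partial>M) = (\<integral>\<^sup>+x. D x \<partial>M)"
    using Dd by (intro nn_integral_cong_AE) auto
  also have "ennreal (L powr (- (1 / p))) * ennreal L + ennreal (L powr e) * \<dots>
     \<le> ennreal (L powr e) + ennreal (L powr e) * 1"
  proof (intro add_mono mult_left_mono D)
    have "L powr (- (1 / p)) * L = L powr e"
      using L by (simp add: e_def powr_mult_base mult.commute)
    then show "ennreal (L powr (- (1 / p))) * ennreal L \<le> ennreal (L powr e)"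
      using L by (simp flip: ennreal_mult)
  qed auto
  also have "\<dots> = ennreal W"
    by (simp add: W_def flip: ennreal_plus)
  finally have wW: "(\<integral>\<^sup>+x\<in>E. ennreal (w x) \<partial>M) \<le> ennreal W" .

  let ?c = "2 powr q * 2 powr (q - 1)"
  have coeff: "(L powr (- e)) powr q * (2 powr q * W powr (q - 1)) = ?c * L powr (- e)"
  proof -
    have "(L powr (- e)) powr q * (L powr e) powr (q - 1) = L powr (- e)"
      using L by (simp add: powr_powr algebra_simps flip: powr_add)
    then show ?thesis
      using L by (simp add: W_def powr_mult)
  qed
  have "(\<integral>\<^sup>+i. ennpow (ennreal (L powr (- e)) * (\<integral>\<^sup>+x\<in>E. A i x \<partial>M)) q \<partial>count_space UNIV)
     \<le> (\<integral>\<^sup>+i. ennreal (?c * L powr (- e)) * (\<integral>\<^sup>+x\<in>E. ennpow (A i x) q * ennreal (w x powr (1 - q)) \<partial>M) \<partial>count_space UNIV)"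
  proof (intro nn_integral_mono)
    fix i
    have "ennpow (ennreal (L powr (- e)) * (\<integral>\<^sup>+x\<in>E. A i x \<partial>M)) q
        = ennreal ((L powr (- e)) powr q) * ennpow (\<integral>\<^sup>+x\<in>E. A i x \<partial>M) q"
      by (simp add: ennpow_mult ennpow_ennreal)
    also have "\<dots> \<le> ennreal ((L powr (- e)) powr q) * (ennreal (2 powr q * W powr (q - 1))
        * (\<integral>\<^sup>+x\<in>E. ennpow (A i x) q * ennreal (w x powr (1 - q)) \<partial>M))"
      using p by (intro mult_left_mono Holder_with_density W w wW) auto
    also have "\<dots> = ennreal (?c * L powr (- e)) * (\<integral>\<^sup>+x\<in>E. ennpow (A i x) q * ennreal (w x powr (1 - q)) \<partial>M)"
      unfolding coeff[symmetric] by (simp add: ennreal_mult mult.assoc)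
    finally show "ennpow (ennreal (L powr (- e)) * (\<integral>\<^sup>+x\<in>E. A i x \<partial>M)) q \<le> \<dots>" .
  qed
  also have "\<dots> = ennreal (?c * L powr (- e)) *
      (\<integral>\<^sup>+i. (\<integral>\<^sup>+x. ennpow (A i x) q * (ennreal (w x powr (1 - q)) * indicator E x) \<partial>M) \<partial>count_space UNIV)"
    by (simp add: nn_integral_cmult mult.assoc)
  also have "(\<integral>\<^sup>+i. (\<integral>\<^sup>+x. ennpow (A i x) q * (ennreal (w x powr (1 - q)) * indicator E x) \<partial>M) \<partial>count_space UNIV)
     = (\<integral>\<^sup>+x. (\<integral>\<^sup>+i. ennpow (A i x) q * (ennreal (w x powr (1 - q)) * indicator E x) \<partial>count_space UNIV) \<partial>M)"
    by (rule nn_integral_count_space_nn_integral[symmetric]) auto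
  also have "\<dots> = (\<integral>\<^sup>+x. (\<integral>\<^sup>+i. ennpow (A i x) q \<partial>count_space UNIV) * (ennreal (w x powr (1 - q)) * indicator E x) \<partial>M)"
    by (simp add: nn_integral_multc)
  also have "ennreal (?c * L powr (- e)) * \<dots> \<le> ennreal (?c * L powr (- e)) *
     (\<integral>\<^sup>+x. K * (ennpow (D x) (q / p) * (ennreal (w x powr (1 - q)) * indicator E x)) \<partial>M)"
    using le by (intro mult_left_mono nn_integral_mono_AE)
      (auto elim!: eventually_mono simp: mult.assoc[symmetric] intro!: mult_right_mono)
  also have "\<dots> = ennreal ?c * K * (\<integral>\<^sup>+x. ennreal (L powr (- e)) * (ennpow (D x) (q / p) * (ennreal (w x powr (1 - q)) * indicator E x)) \<partial>M)"
    by (subst nn_integral_cmult, simp)+ (simp add: ennreal_mult mult_ac)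
  also have "\<dots> \<le> ennreal ?c * K * (\<integral>\<^sup>+x\<in>E. D x * ennreal (dyadic_kernel p q (L * d x)) \<partial>M)"
  proof (intro mult_left_mono nn_integral_mono_AE)
    show "AE x in M. ennreal (L powr (- e)) * (ennpow (D x) (q / p) * (ennreal (w x powr (1 - q)) * indicator E x))
       \<le> D x * ennreal (dyadic_kernel p q (L * d x)) * indicator E x"
      using Dd
    proof eventually_elim
      case (elim x)
      have "ennreal (L powr (- e)) * (ennpow (D x) (q / p) * ennreal (w x powr (1 - q)))
        = ennreal (L powr (- e) * (d x powr (q / p) * w x powr (1 - q)))"
        using d[of x] by (simp add: elim ennpow_ennreal ennreal_mult)
      also have "\<dots> \<le> ennreal (d x * dyadic_kernel p q (L * d x))"
        unfolding w_def e_def using p L d[of x] by (intro ennreal_leI dyadic_kernel_bound)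
      also have "\<dots> = D x * ennreal (dyadic_kernel p q (L * d x))"
        using d[of x] by (simp add: elim ennreal_mult')
      finally show ?case
        by (auto split: split_indicator)
    qed
  qed auto
  finally show ?thesis
    by (simp add: d_def e_def)
qed

text \<open>
  A Carleson embedding. After the estimate on each interval, the sum over all
  intervals acts pointwise on \<open>D\<close>: positions cost a factor \<open>3\<close> by bounded overlap, and the sum of
  the kernel over the scales is bounded.
\<close>

lemma dyadic_embedding_vector:
  assumes p: "1 < p" "p < q"
  obtains C :: real where "0 < C"
    and "\<And>(A :: 'i::countable \<Rightarrow> real \<Rightarrow> ennreal) D K.
      \<lbrakk>\<And>i. A i \<in> borel_measurable lborel; D \<in> borel_measurable lborel;
       AE x in lborel. (\<integral>\<^sup>+i. ennpow (A i x) q \<partial>count_space UNIV) \<le> K * ennpow (D x) (q / p);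
       (\<integral>\<^sup>+x. D x \<partial>lborel) \<le> 1\<rbrakk>
      \<Longrightarrow> (\<integral>\<^sup>+I. \<integral>\<^sup>+i. ennpow (ennreal (tripled_length I powr (- (1 - 1 / p)))
            * (\<integral>\<^sup>+x\<in>tripled_dyadic I. A i x \<partial>lborel)) q \<partial>count_space UNIV \<partial>count_space UNIV)
        \<le> ennreal C * K"
proof -
  have ab: "0 < 1 - 1 / p" "0 < q / p - 1" using p by auto
  obtain C0 where C0: "0 < C0"
    and kernel_sum: "\<And>s. 0 < s \<Longrightarrow> (\<integral>\<^sup>+k. ennreal (dyadic_kernel p q (2 powr real_of_int k * s)) \<partial>count_space UNIV) \<le> ennreal C0"
    unfolding dyadic_kernel_def by (rule dyadic_kernel_sum[OF ab]) blast
  let ?c = "2 powr q * 2 powr (q - 1)"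
  show thesis
  proof (rule that[of "?c * (3 * C0)"])
    show "0 < ?c * (3 * C0)" using C0 by simp
    fix A :: "'i \<Rightarrow> real \<Rightarrow> ennreal" and D :: "real \<Rightarrow> ennreal" and K
    assume [measurable]: "\<And>i. A i \<in> borel_measurable lborel" "D \<in> borel_measurable lborel"
      and le: "AE x in lborel. (\<integral>\<^sup>+i. ennpow (A i x) q \<partial>count_space UNIV) \<le> K * ennpow (D x) (q / p)"
      and D: "(\<integral>\<^sup>+x. D x \<partial>lborel) \<le> 1"
    let ?k = "\<lambda>I x. ennreal (dyadic_kernel p q (tripled_length I * enn2real (D x)))"
    have pointwise: "(\<integral>\<^sup>+I. D x * ?k I x * indicator (tripled_dyadic I) x \<partial>count_space UNIV)
        \<le> ennreal (3 * C0) * D x" if fin: "D x \<noteq> \<infinity>" for x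
    proof (cases "D x = 0")
      case True
      then show ?thesis by simp
    next
      case False
      define d where "d = enn2real (D x)"
      have d: "0 < d" using False fin by (simp add: d_def enn2real_positive_iff less_top zero_less_iff_neq_zero)
      have "(\<integral>\<^sup>+I. ?k I x * indicator (tripled_dyadic I) x \<partial>count_space UNIV)
         = (\<integral>\<^sup>+k. \<integral>\<^sup>+n. ?k (k, n) x * indicator (tripled_dyadic (k, n)) x \<partial>count_space UNIV \<partial>count_space UNIV)"
        by (rule nn_integral_fst_count_space[symmetric])
      also have "\<dots> = (\<integral>\<^sup>+k. ennreal (dyadic_kernel p q (2 powr real_of_int k * (3 * d)))
          * (\<integral>\<^sup>+n. indicator (tripled_dyadic (k, n)) x \<partial>count_space UNIV) \<partial>count_space UNIV)"
        by (intro nn_integral_cong, subst nn_integral_cmult[symmetric])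
          (simp_all add: tripled_length_def d_def mult_ac)
      also have "\<dots> \<le> (\<integral>\<^sup>+k. ennreal (dyadic_kernel p q (2 powr real_of_int k * (3 * d))) * 3 \<partial>count_space UNIV)"
        by (intro nn_integral_mono mult_left_mono tripled_dyadic_overlap) auto
      also have "\<dots> = (\<integral>\<^sup>+k. ennreal (dyadic_kernel p q (2 powr real_of_int k * (3 * d))) \<partial>count_space UNIV) * 3"
        by (rule nn_integral_multc) auto
      also have "\<dots> \<le> ennreal C0 * 3"
        using d by (intro mult_right_mono kernel_sum) auto
      also have "\<dots> = ennreal (3 * C0)"
        using C0 by (simp add: ennreal_mult' mult.commute)
      finally have "D x * (\<integral>\<^sup>+I. ?k I x * indicator (tripled_dyadic I) x \<partial>count_space UNIV) \<le> D x * ennreal (3 * C0)"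
        by (rule mult_left_mono) auto
      moreover have "(\<integral>\<^sup>+I. D x * ?k I x * indicator (tripled_dyadic I) x \<partial>count_space UNIV)
          = D x * (\<integral>\<^sup>+I. ?k I x * indicator (tripled_dyadic I) x \<partial>count_space UNIV)"
        unfolding mult.assoc by (rule nn_integral_cmult) auto
      ultimately show ?thesis
        by (simp add: mult.commute)
    qed
    have "AE x in lborel. D x \<noteq> \<infinity>"
      using D by (intro nn_integral_noteq_infinite) (auto simp: top_unique)
    then have AE: "AE x in lborel. (\<integral>\<^sup>+I. D x * ?k I x * indicator (tripled_dyadic I) x \<partial>count_space UNIV)
        \<le> ennreal (3 * C0) * D x"
      by (rule eventually_mono) (rule pointwise)
    have "(\<integral>\<^sup>+I. (\<integral>\<^sup>+x\<in>tripled_dyadic I. D x * ?k I x \<partial>lborel) \<partial>count_space UNIV)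
        = (\<integral>\<^sup>+x. \<integral>\<^sup>+I. D x * ?k I x * indicator (tripled_dyadic I) x \<partial>count_space UNIV \<partial>lborel)"
      by (rule nn_integral_count_space_nn_integral[symmetric]) auto
    also have "\<dots> \<le> (\<integral>\<^sup>+x. ennreal (3 * C0) * D x \<partial>lborel)"
      by (rule nn_integral_mono_AE) (rule AE)
    also have "\<dots> = ennreal (3 * C0) * (\<integral>\<^sup>+x. D x \<partial>lborel)"
      by (rule nn_integral_cmult) auto
    also have "\<dots> \<le> ennreal (3 * C0) * 1"
      by (intro mult_left_mono D) auto
    finally have sum_le: "(\<integral>\<^sup>+I. (\<integral>\<^sup>+x\<in>tripled_dyadic I. D x * ?k I x \<partial>lborel) \<partial>count_space UNIV)
        \<le> ennreal (3 * C0)"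
      by simp
    have "(\<integral>\<^sup>+I. \<integral>\<^sup>+i. ennpow (ennreal (tripled_length I powr (- (1 - 1 / p)))
            * (\<integral>\<^sup>+x\<in>tripled_dyadic I. A i x \<partial>lborel)) q \<partial>count_space UNIV \<partial>count_space UNIV)
        \<le> (\<integral>\<^sup>+I. ennreal ?c * K * (\<integral>\<^sup>+x\<in>tripled_dyadic I. D x * ?k I x \<partial>lborel) \<partial>count_space UNIV)"
      using p le D by (intro nn_integral_mono interval_estimate emeasure_tripled_dyadic) auto
    also have "\<dots> = ennreal ?c * K * (\<integral>\<^sup>+I. (\<integral>\<^sup>+x\<in>tripled_dyadic I. D x * ?k I x \<partial>lborel) \<partial>count_space UNIV)"
      by (rule nn_integral_cmult) auto
    also have "\<dots> \<le> ennreal ?c * K * ennreal (3 * C0)"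
      by (intro mult_left_mono sum_le) auto
    also have "\<dots> = ennreal (?c * (3 * C0)) * K"
      using C0 by (subst (2) ennreal_mult) (auto simp: mult_ac)
    finally show "(\<integral>\<^sup>+I. \<integral>\<^sup>+i. ennpow (ennreal (tripled_length I powr (- (1 - 1 / p)))
            * (\<integral>\<^sup>+x\<in>tripled_dyadic I. A i x \<partial>lborel)) q \<partial>count_space UNIV \<partial>count_space UNIV)
        \<le> ennreal (?c * (3 * C0)) * K" .
  qed
qed

text \<open>
  The scalar case, one function \<open>A = \<phi>\<close> with \<open>D = \<phi>\<^sup>p\<close>, made homogeneous so that it can be applied to
  every slice of a function of two variables.
\<close>

lemma dyadic_embedding:
  assumes p: "1 < p" "p < q"
  obtains C :: real where "0 < C"
    and "\<And>\<phi>. \<phi> \<in> borel_measurable lborel \<Longrightarrow>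
      (\<integral>\<^sup>+J. ennpow (ennreal (tripled_length J powr (- (1 - 1 / p)))
            * (\<integral>\<^sup>+x\<in>tripled_dyadic J. \<phi> x \<partial>lborel)) q \<partial>count_space UNIV)
        \<le> ennreal C * ennpow (\<integral>\<^sup>+x. ennpow (\<phi> x) p \<partial>lborel) (q / p)"
proof -
  obtain C :: real where C: "0 < C"
    and emb: "\<And>(A :: unit \<Rightarrow> real \<Rightarrow> ennreal) D K.
      \<lbrakk>\<And>i. A i \<in> borel_measurable lborel; D \<in> borel_measurable lborel;
       AE x in lborel. (\<integral>\<^sup>+i. ennpow (A i x) q \<partial>count_space UNIV) \<le> K * ennpow (D x) (q / p);
       (\<integral>\<^sup>+x. D x \<partial>lborel) \<le> 1\<rbrakk>
      \<Longrightarrow> (\<integral>\<^sup>+I. \<integral>\<^sup>+i. ennpow (ennreal (tripled_length I powr (- (1 - 1 / p)))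
            * (\<integral>\<^sup>+x\<in>tripled_dyadic I. A i x \<partial>lborel)) q \<partial>count_space UNIV \<partial>count_space UNIV)
        \<le> ennreal C * K"
    by (rule dyadic_embedding_vector[OF p]) blast
  show thesis
  proof (rule that[OF C])
    fix \<phi> :: "real \<Rightarrow> ennreal" assume [measurable]: "\<phi> \<in> borel_measurable lborel"
    let ?S = "\<lambda>\<phi>. (\<integral>\<^sup>+J. ennpow (ennreal (tripled_length J powr (- (1 - 1 / p)))
            * (\<integral>\<^sup>+x\<in>tripled_dyadic J. \<phi> x \<partial>lborel)) q \<partial>count_space UNIV)"
    show "?S \<phi> \<le> ennreal C * ennpow (\<integral>\<^sup>+x. ennpow (\<phi> x) p \<partial>lborel) (q / p)"
    proof (cases "\<integral>\<^sup>+x. ennpow (\<phi> x) p \<partial>lborel")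
      case top
      then show ?thesis using C by (simp add: ennreal_mult_top)
    next
      case (real s)
      show ?thesis
      proof (cases "s = 0")
        case True
        with real have "AE x in lborel. \<phi> x = 0"
          by (simp add: nn_integral_0_iff_AE)
        then have "(\<integral>\<^sup>+x\<in>tripled_dyadic J. \<phi> x \<partial>lborel) = 0" for J
          by (subst nn_integral_0_iff_AE) (auto elim!: eventually_mono)
        then show ?thesis by simp
      next
        case False
        with real have s: "0 < s" by simp
        let ?t = "ennreal (s powr (- (1 / p)))"
        have "(s powr (- (1 / p))) powr p = s powr (- 1)"
          using p by (subst powr_powr) simp
        then have tp: "ennpow ?t p = ennreal (1 / s)"
          using s by (subst ennpow_ennreal) (simp, simp add: powr_minus_divide)
        have "(\<integral>\<^sup>+x. ennpow (?t * \<phi> x) p \<partial>lborel) = ennpow ?t p * (\<integral>\<^sup>+x. ennpow (\<phi> x) p \<partial>lborel)"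
          by (simp add: ennpow_mult nn_integral_cmult)
        also have "ennpow ?t p = ennreal (1 / s)"
          by (rule tp)
        also have "ennreal (1 / s) * (\<integral>\<^sup>+x. ennpow (\<phi> x) p \<partial>lborel) = 1"
          using s by (simp add: real flip: ennreal_mult)
        finally have "?S (\<lambda>x. ?t * \<phi> x) \<le> ennreal C"
          using emb[of "\<lambda>_ x. ?t * \<phi> x" "\<lambda>x. ennpow (?t * \<phi> x) p" 1] p
          by (simp add: ennpow_ennpow nn_integral_count_space_finite)
        moreover have "(\<integral>\<^sup>+x\<in>tripled_dyadic J. ?t * \<phi> x \<partial>lborel)
            = ?t * (\<integral>\<^sup>+x\<in>tripled_dyadic J. \<phi> x \<partial>lborel)" for J
          unfolding mult.assoc by (rule nn_integral_cmult) measurable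
        then have "?S (\<lambda>x. ?t * \<phi> x) = ennpow ?t q * ?S \<phi>"
          by (subst nn_integral_cmult[symmetric]) (auto simp: ennpow_mult mult_ac)
        ultimately have "ennreal (s powr (q / p)) * (ennpow ?t q * ?S \<phi>) \<le> ennreal (s powr (q / p)) * ennreal C"
          by (intro mult_left_mono) auto
        moreover have "ennreal (s powr (q / p)) * ennpow ?t q = 1"
          using s by (simp add: ennpow_ennreal powr_powr flip: ennreal_mult powr_add)
        ultimately show ?thesis
          using s by (simp add: real ennpow_ennreal mult.commute flip: mult.assoc)
      qed
    qed
  qed
qed

section \<open>The embedding over dyadic rectangles\<close>

text \<open>
  For fixed \<open>x\<close> the scalar embedding in \<open>y\<close> bounds the sum over \<open>J\<close> of the \<open>q\<close>-th powers of the normalized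
  integrals of \<open>G(x, \<cdot>)\<close> over \<open>J\<close> by the power \<open>q/p\<close> of \<open>D(x) = \<integral> G(x, y)\<^sup>p dy\<close>. This is the hypothesis of the vector embedding in
  \<open>x\<close>, applied to the family indexed by \<open>J\<close>.
\<close>

lemma rectangle_embedding:
  assumes p: "1 < p" "p < q"
  obtains C :: real where "0 < C"
    and "\<And>G :: real \<times> real \<Rightarrow> ennreal. G \<in> borel_measurable lborel \<Longrightarrow>
      (\<integral>\<^sup>+z. ennpow (G z) p \<partial>lborel) \<le> 1 \<Longrightarrow>
      (\<integral>\<^sup>+R. ennpow (ennreal ((tripled_length (fst R) * tripled_length (snd R)) powr (- (1 - 1 / p)))
            * (\<integral>\<^sup>+z\<in>tripled_dyadic (fst R) \<times> tripled_dyadic (snd R). G z \<partial>lborel)) q \<partial>count_space UNIV)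
        \<le> ennreal C"
proof -
  obtain C1 where C1: "0 < C1" and emb1: "\<And>\<phi>. \<phi> \<in> borel_measurable lborel \<Longrightarrow>
      (\<integral>\<^sup>+J. ennpow (ennreal (tripled_length J powr (- (1 - 1 / p)))
            * (\<integral>\<^sup>+x\<in>tripled_dyadic J. \<phi> x \<partial>lborel)) q \<partial>count_space UNIV)
        \<le> ennreal C1 * ennpow (\<integral>\<^sup>+x. ennpow (\<phi> x) p \<partial>lborel) (q / p)"
    by (rule dyadic_embedding[OF p]) blast
  obtain C2 :: real where C2: "0 < C2"
    and emb2: "\<And>(A :: int \<times> int \<Rightarrow> real \<Rightarrow> ennreal) D K.
      \<lbrakk>\<And>i. A i \<in> borel_measurable lborel; D \<in> borel_measurable lborel;
       AE x in lborel. (\<integral>\<^sup>+i. ennpow (A i x) q \<partial>count_space UNIV) \<le> K * ennpow (D x) (q / p);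
       (\<integral>\<^sup>+x. D x \<partial>lborel) \<le> 1\<rbrakk>
      \<Longrightarrow> (\<integral>\<^sup>+I. \<integral>\<^sup>+i. ennpow (ennreal (tripled_length I powr (- (1 - 1 / p)))
            * (\<integral>\<^sup>+x\<in>tripled_dyadic I. A i x \<partial>lborel)) q \<partial>count_space UNIV \<partial>count_space UNIV)
        \<le> ennreal C2 * K"
    by (rule dyadic_embedding_vector[OF p]) blast
  show thesis
  proof (rule that[of "C2 * C1"])
    show "0 < C2 * C1" using C1 C2 by simp
    fix G :: "real \<times> real \<Rightarrow> ennreal"
    assume "G \<in> borel_measurable lborel" and int: "(\<integral>\<^sup>+z. ennpow (G z) p \<partial>lborel) \<le> 1"
    then have G [measurable]: "G \<in> borel_measurable (lborel \<Otimes>\<^sub>M lborel)"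
      by (simp add: lborel_prod)
    let ?e = "- (1 - 1 / p)"
    define A where "A J x = ennreal (tripled_length J powr ?e) * (\<integral>\<^sup>+y\<in>tripled_dyadic J. G (x, y) \<partial>lborel)"
      for J x
    define D where "D x = (\<integral>\<^sup>+y. ennpow (G (x, y)) p \<partial>lborel)" for x
    have [measurable]: "A J \<in> borel_measurable lborel" for J
      unfolding A_def by measurable
    have [measurable]: "D \<in> borel_measurable lborel"
      unfolding D_def by measurable
    have "(\<integral>\<^sup>+x. D x \<partial>lborel) = (\<integral>\<^sup>+z. ennpow (G z) p \<partial>(lborel \<Otimes>\<^sub>M lborel))"
      unfolding D_def by (rule lborel.nn_integral_fst) simp
    then have D: "(\<integral>\<^sup>+x. D x \<partial>lborel) \<le> 1"
      using int by (simp add: lborel_prod)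
    have le: "AE x in lborel. (\<integral>\<^sup>+J. ennpow (A J x) q \<partial>count_space UNIV) \<le> ennreal C1 * ennpow (D x) (q / p)"
      unfolding A_def D_def by (intro AE_I2 emb1) simp
    have iterated: "ennreal (tripled_length I powr ?e) * (\<integral>\<^sup>+x\<in>tripled_dyadic I. A J x \<partial>lborel)
       = ennreal ((tripled_length I * tripled_length J) powr ?e)
            * (\<integral>\<^sup>+z\<in>tripled_dyadic I \<times> tripled_dyadic J. G z \<partial>lborel)" for I J
    proof -
      have "(\<integral>\<^sup>+z\<in>tripled_dyadic I \<times> tripled_dyadic J. G z \<partial>lborel)
        = (\<integral>\<^sup>+x. \<integral>\<^sup>+y. G (x, y) * indicator (tripled_dyadic I \<times> tripled_dyadic J) (x, y) \<partial>lborel \<partial>lborel)"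
        unfolding lborel_prod[symmetric] by (rule lborel.nn_integral_fst[symmetric]) simp
      also have "\<dots> = (\<integral>\<^sup>+x. (\<integral>\<^sup>+y\<in>tripled_dyadic J. G (x, y) \<partial>lborel) * indicator (tripled_dyadic I) x \<partial>lborel)"
        by (intro nn_integral_cong, subst nn_integral_multc[symmetric])
          (simp_all add: indicator_times mult_ac)
      finally have *: "(\<integral>\<^sup>+z\<in>tripled_dyadic I \<times> tripled_dyadic J. G z \<partial>lborel) = \<dots>" .
      have "(\<integral>\<^sup>+x\<in>tripled_dyadic I. A J x \<partial>lborel) = ennreal (tripled_length J powr ?e)
          * (\<integral>\<^sup>+x. (\<integral>\<^sup>+y\<in>tripled_dyadic J. G (x, y) \<partial>lborel) * indicator (tripled_dyadic I) x \<partial>lborel)"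
        unfolding A_def mult.assoc by (rule nn_integral_cmult) measurable
      then show ?thesis
        unfolding * by (simp add: powr_mult ennreal_mult mult.assoc)
    qed
    have "(\<integral>\<^sup>+R. ennpow (ennreal ((tripled_length (fst R) * tripled_length (snd R)) powr ?e)
            * (\<integral>\<^sup>+z\<in>tripled_dyadic (fst R) \<times> tripled_dyadic (snd R). G z \<partial>lborel)) q \<partial>count_space UNIV)
      = (\<integral>\<^sup>+I. \<integral>\<^sup>+J. ennpow (ennreal ((tripled_length I * tripled_length J) powr ?e)
            * (\<integral>\<^sup>+z\<in>tripled_dyadic I \<times> tripled_dyadic J. G z \<partial>lborel)) q \<partial>count_space UNIV \<partial>count_space UNIV)"
      by (subst nn_integral_fst_count_space[symmetric]) simp
    also have "\<dots> \<le> ennreal C2 * ennreal C1"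
      unfolding iterated[symmetric] by (intro emb2[of A D] le D) auto
    also have "\<dots> = ennreal (C2 * C1)"
      using C1 C2 by (simp add: ennreal_mult)
    finally show "(\<integral>\<^sup>+R. ennpow (ennreal ((tripled_length (fst R) * tripled_length (snd R)) powr ?e)
            * (\<integral>\<^sup>+z\<in>tripled_dyadic (fst R) \<times> tripled_dyadic (snd R). G z \<partial>lborel)) q \<partial>count_space UNIV)
      \<le> ennreal (C2 * C1)" .
  qed
qed

definition tripled_rectangle :: "(int \<times> int) \<times> (int \<times> int) \<Rightarrow> (real \<times> real) set" where
  "tripled_rectangle R = tripled_dyadic (fst R) \<times> tripled_dyadic (snd R)"

definition tripled_area :: "(int \<times> int) \<times> (int \<times> int) \<Rightarrow> real" where
  "tripled_area R = tripled_length (fst R) * tripled_length (snd R)"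

lemma tripled_area_pos [simp]: "0 < tripled_area R"
  by (simp add: tripled_area_def)

lemma tripled_rectangle_sets [measurable]: "tripled_rectangle R \<in> sets lebesgue"
proof -
  have "tripled_rectangle R \<in> sets (borel :: (real \<times> real) measure)"
    unfolding tripled_rectangle_def borel_prod[symmetric] by measurable
  then show ?thesis by simp
qed

lemma measure_tripled_rectangle:
  "measure lebesgue (tripled_dyadic I \<times> tripled_dyadic J) = tripled_length I * tripled_length J"
proof -
  have "emeasure lborel (tripled_dyadic I \<times> tripled_dyadic J)
      = ennreal (tripled_length I) * ennreal (tripled_length J)"
    unfolding lborel_prod[symmetric] emeasure_tripled_dyadic[symmetric]
    by (rule lborel.emeasure_pair_measure_Times) auto
  moreover have "tripled_dyadic I \<times> tripled_dyadic J \<in> sets borel"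
    unfolding borel_prod[symmetric] by measurable
  ultimately show ?thesis
    by (simp add: measure_def less_imp_le flip: ennreal_mult)
qed

text \<open>
  Fubini's theorem needs Borel functions, but a Lebesgue measurable function agrees almost everywhere
  with a Borel one.
\<close>

lemma rectangle_embedding_lebesgue:
  assumes p: "1 < p" "p < q"
  obtains C :: real where "0 < C"
    and "\<And>G. G \<in> borel_measurable lebesgue \<Longrightarrow>
      (\<integral>\<^sup>+z. ennpow (G z) p \<partial>lebesgue) \<le> 1 \<Longrightarrow>
      (\<integral>\<^sup>+R. ennpow (ennreal (tripled_area R powr (- (1 - 1 / p)))
            * (\<integral>\<^sup>+z\<in>tripled_rectangle R. G z \<partial>lebesgue)) q \<partial>count_space UNIV)
        \<le> ennreal C"
proof -
  obtain C where C: "0 < C" and emb: "\<And>G :: real \<times> real \<Rightarrow> ennreal. G \<in> borel_measurable lborel \<Longrightarrow>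
      (\<integral>\<^sup>+z. ennpow (G z) p \<partial>lborel) \<le> 1 \<Longrightarrow>
      (\<integral>\<^sup>+R. ennpow (ennreal ((tripled_length (fst R) * tripled_length (snd R)) powr (- (1 - 1 / p)))
            * (\<integral>\<^sup>+z\<in>tripled_dyadic (fst R) \<times> tripled_dyadic (snd R). G z \<partial>lborel)) q \<partial>count_space UNIV)
        \<le> ennreal C"
    by (rule rectangle_embedding[OF p]) blast
  show thesis
  proof (rule that[OF C])
    fix G :: "real \<times> real \<Rightarrow> ennreal"
    assume "G \<in> borel_measurable lebesgue" and int: "(\<integral>\<^sup>+z. ennpow (G z) p \<partial>lebesgue) \<le> 1"
    then obtain G' where G': "G' \<in> borel_measurable lborel" "AE z in lborel. G z = G' z"
      using completion_ex_borel_measurable[of G lborel] by blast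
    have "(\<integral>\<^sup>+z. ennpow (G' z) p \<partial>lborel) = (\<integral>\<^sup>+z. ennpow (G z) p \<partial>lborel)"
      using G'(2) by (intro nn_integral_cong_AE) (auto elim!: eventually_mono)
    with int have "(\<integral>\<^sup>+z. ennpow (G' z) p \<partial>lborel) \<le> 1"
      by (simp add: nn_integral_completion)
    note emb[OF G'(1) this]
    moreover have "(\<integral>\<^sup>+z\<in>tripled_rectangle R. G z \<partial>lebesgue)
        = (\<integral>\<^sup>+z\<in>tripled_dyadic (fst R) \<times> tripled_dyadic (snd R). G' z \<partial>lborel)" for R
      unfolding nn_integral_completion tripled_rectangle_def
      using G'(2) by (intro nn_integral_cong_AE) auto
    ultimately show "(\<integral>\<^sup>+R. ennpow (ennreal (tripled_area R powr (- (1 - 1 / p)))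
            * (\<integral>\<^sup>+z\<in>tripled_rectangle R. G z \<partial>lebesgue)) q \<partial>count_space UNIV) \<le> ennreal C"
      by (simp add: tripled_area_def)
  qed
qed

section \<open>The strong maximal function on dyadic rectangles\<close>

text \<open>
  Exponents of one variable are only Lebesgue measurable; as functions on the plane they stay so because
  cylinders over null sets are null.
\<close>

lemma lebesgue_measurable_fst:
  "(fst :: real \<times> real \<Rightarrow> real) \<in> lebesgue \<rightarrow>\<^sub>M lebesgue"
proof (rule completion.measurable_completion2)
  show m: "fst \<in> (lebesgue :: (real \<times> real) measure) \<rightarrow>\<^sub>M lborel"
    by (intro measurable_completion)
      (simp add: borel_measurable_continuous_onI continuous_on_fst continuous_on_id)
  show "null_sets lborel \<subseteq> null_sets (distr lebesgue lborel (fst :: real \<times> real \<Rightarrow> real))"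
  proof
    fix A :: "real set" assume A: "A \<in> null_sets lborel"
    then have A_borel: "A \<in> sets borel" by auto
    have "A \<times> UNIV \<in> null_sets (lborel \<Otimes>\<^sub>M (lborel :: real measure))"
      using A by (intro lborel.times_in_null_sets1) auto
    then have "A \<times> (UNIV :: real set) \<in> null_sets lebesgue"
      by (simp add: lborel_prod null_sets_completionI)
    moreover have "fst -` A = A \<times> (UNIV :: real set)" by auto
    ultimately show "A \<in> null_sets (distr lebesgue lborel (fst :: real \<times> real \<Rightarrow> real))"
      using A_borel m by (simp add: null_sets_distr_iff)
  qed
qed

lemma lebesgue_measurable_snd:
  "(snd :: real \<times> real \<Rightarrow> real) \<in> lebesgue \<rightarrow>\<^sub>M lebesgue"
proof (rule completion.measurable_completion2)
  show m: "snd \<in> (lebesgue :: (real \<times> real) measure) \<rightarrow>\<^sub>M lborel"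
    by (intro measurable_completion)
      (simp add: borel_measurable_continuous_onI continuous_on_snd continuous_on_id)
  show "null_sets lborel \<subseteq> null_sets (distr lebesgue lborel (snd :: real \<times> real \<Rightarrow> real))"
  proof
    fix A :: "real set" assume A: "A \<in> null_sets lborel"
    then have A_borel: "A \<in> sets borel" by auto
    have "UNIV \<times> A \<in> null_sets ((lborel :: real measure) \<Otimes>\<^sub>M lborel)"
      using A by (intro lborel.times_in_null_sets2) auto
    then have "(UNIV :: real set) \<times> A \<in> null_sets lebesgue"
      by (simp add: lborel_prod null_sets_completionI)
    moreover have "snd -` A = (UNIV :: real set) \<times> A" by auto
    ultimately show "A \<in> null_sets (distr lebesgue lborel (snd :: real \<times> real \<Rightarrow> real))"
      using A_borel m by (simp add: null_sets_distr_iff)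
  qed
qed

text \<open>
  The function whose norm over \<open>I \<times> J\<close> enters the weight maximal functions, for a tripled dyadic
  rectangle.
\<close>

definition rectangle_weight ::
  "(real \<Rightarrow> real) \<Rightarrow> (real \<Rightarrow> real) \<Rightarrow> (real \<times> real \<Rightarrow> real) \<Rightarrow> (int \<times> int) \<times> (int \<times> int) \<Rightarrow> real \<times> real \<Rightarrow> ennreal" where
  "rectangle_weight \<alpha> \<beta> v R z = ennreal \<bar>v z * tripled_length (fst R) powr \<alpha> (fst z)
     * tripled_length (snd R) powr \<beta> (snd z)\<bar>"

lemma rectangle_weight_measurable:
  assumes "\<alpha> \<in> borel_measurable lebesgue" "\<beta> \<in> borel_measurable lebesgue" "v \<in> borel_measurable lebesgue"
  shows "rectangle_weight \<alpha> \<beta> v R \<in> borel_measurable lebesgue"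
proof -
  note [measurable] = assms measurable_compose[OF lebesgue_measurable_fst assms(1)]
    measurable_compose[OF lebesgue_measurable_snd assms(2)]
  show ?thesis unfolding rectangle_weight_def by measurable
qed

lemma weight_maximal_exp_ge:
  assumes "z \<in> tripled_rectangle R"
  shows "ennreal (tripled_area R powr (- (1 / r))) * var_norm (tripled_rectangle R) q (rectangle_weight \<alpha> \<beta> v R)
    \<le> weight_maximal_exp r q \<alpha> \<beta> v z"
proof -
  obtain x y where z: "z = (x, y)" by (cases z)
  let ?I = "tripled_dyadic (fst R)" and ?J = "tripled_dyadic (snd R)"
  have I: "?I \<in> intervals_at x" and J: "?J \<in> intervals_at y"
    using assms by (auto simp: z tripled_rectangle_def intro: tripled_dyadic_in_intervals_at)
  have "rectangle_weight \<alpha> \<beta> v R = (\<lambda>(s, t). ennreal \<bar>v (s, t) * measure lebesgue ?I powr \<alpha> s * measure lebesgue ?J powr \<beta> t\<bar>)"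
    by (auto simp: rectangle_weight_def measure_tripled_dyadic)
  then show ?thesis
    unfolding weight_maximal_exp_def z prod.case
    by (intro SUP_upper2[OF I] SUP_upper2[OF J])
      (simp add: measure_tripled_rectangle tripled_area_def tripled_rectangle_def)
qed

text \<open>
  Since \<open>\<alpha>\<close> lies between \<open>0\<close> and \<open>1\<close>, enlarging an interval to one at most six times as long costs at most
  a factor \<open>6\<close> in \<open>\<bar>I\<bar>\<^sup>\<alpha>\<^sup>-\<^sup>1\<close>, uniformly in the point.
\<close>

lemma strong_maximal_le:
  assumes \<alpha>: "0 < \<alpha> x" "\<alpha> x < 1" and \<beta>: "0 < \<beta> y" "\<beta> y < 1"
  shows "strong_maximal \<alpha> \<beta> f (x, y) \<le> (SUP R. indicator (tripled_rectangle R) (x, y) *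
      (ennreal (36 * (tripled_length (fst R) powr (\<alpha> x - 1) * tripled_length (snd R) powr (\<beta> y - 1)))
        * (\<integral>\<^sup>+z\<in>tripled_rectangle R. ennreal \<bar>f z\<bar> \<partial>lebesgue)))" (is "_ \<le> (SUP R. ?F R)")
  unfolding strong_maximal_def prod.case
proof (intro SUP_least)
  fix I J assume I: "I \<in> intervals_at x" and J: "J \<in> intervals_at y"
  have factor: "measure lebesgue I powr (a - 1) \<le> 6 * tripled_length K powr (a - 1)"
    if "I \<in> intervals_at x" "tripled_length K \<le> 6 * measure lebesgue I" "0 < a" "a < 1" for I K x a
  proof -
    have "measure lebesgue I powr (a - 1) \<le> (tripled_length K / 6) powr (a - 1)"
      using that by (intro powr_mono2') auto
    also have "\<dots> = 6 powr (1 - a) * tripled_length K powr (a - 1)"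
      by (simp add: powr_divide powr_diff less_imp_le field_simps)
    also have "\<dots> \<le> 6 powr 1 * tripled_length K powr (a - 1)"
      using that by (intro mult_right_mono powr_mono) auto
    finally show ?thesis by simp
  qed
  obtain I' where I': "I \<subseteq> tripled_dyadic I'" "tripled_length I' \<le> 6 * measure lebesgue I"
    using interval_subset_tripled_dyadic[OF I] by blast
  obtain J' where J': "J \<subseteq> tripled_dyadic J'" "tripled_length J' \<le> 6 * measure lebesgue J"
    using interval_subset_tripled_dyadic[OF J] by blast
  have "(x, y) \<in> tripled_rectangle (I', J')" and sub: "I \<times> J \<subseteq> tripled_rectangle (I', J')"
    using I J I' J' by (auto simp: intervals_at_def tripled_rectangle_def)
  moreover have "measure lebesgue I powr (\<alpha> x - 1) * measure lebesgue J powr (\<beta> y - 1)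
     \<le> (6 * tripled_length I' powr (\<alpha> x - 1)) * (6 * tripled_length J' powr (\<beta> y - 1))"
    using factor[OF I I'(2) \<alpha>] factor[OF J J'(2) \<beta>] by (intro mult_mono) auto
  moreover have "(\<integral>\<^sup>+z\<in>I \<times> J. ennreal \<bar>f z\<bar> \<partial>lebesgue)
      \<le> (\<integral>\<^sup>+z\<in>tripled_rectangle (I', J'). ennreal \<bar>f z\<bar> \<partial>lebesgue)"
    using sub by (intro nn_integral_mono) (auto split: split_indicator)
  ultimately have "ennreal (measure lebesgue I powr (\<alpha> x - 1) * measure lebesgue J powr (\<beta> y - 1))
        * (\<integral>\<^sup>+z\<in>I \<times> J. ennreal \<bar>f z\<bar> \<partial>lebesgue) \<le> ?F (I', J')"
    by (auto intro!: mult_mono ennreal_leI)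
  also have "\<dots> \<le> (SUP R. ?F R)"
    by (rule SUP_upper) simp
  finally show "ennreal (measure lebesgue I powr (\<alpha> x - 1) * measure lebesgue J powr (\<beta> y - 1))
        * (\<integral>\<^sup>+z\<in>I \<times> J. ennreal \<bar>f z\<bar> \<partial>lebesgue) \<le> (SUP R. ?F R)" .
qed

text \<open>
  Let \<open>h = \<bar>f\<bar> / l\<close>, let \<open>N R\<close> be the norm of the weight on the rectangle \<open>R\<close>, and let \<open>g\<close> be \<open>h\<close> times a
  measurable minorant \<open>m\<close> of the weight maximal function. On \<open>R\<close> the function \<open>m\<close> dominates both \<open>\<bar>R\<bar>\<close> to the power \<open>-1/p0\<close> times \<open>N R\<close> and \<open>\<bar>R\<bar>\<close> to the
  power \<open>-1/p1\<close> times \<open>N R\<close>. Using the first where \<open>g > 1\<close> and the second where \<open>g \<le> 1\<close> bounds \<open>N R\<close> times the mean of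
  \<open>h\<close> over \<open>R\<close> by \<open>X R + Y R\<close>, the normalized integrals of the two parts of \<open>g\<close>. The choice is made so that the
  variable exponent can be traded for a constant one on each part: the modular with exponent \<open>p\<close> bounds
  the integral of the \<open>p0\<close>-th power of the large part and of the \<open>p1\<close>-th power of the small part.
  Both embeddings into the sum of \<open>q0\<close>-th powers then apply, as \<open>p0 \<le> p1 < q0\<close>.
\<close>

lemma modular_estimate:
  fixes p q :: "real \<times> real \<Rightarrow> real"
  assumes p: "1 < p0" "\<And>z. p0 \<le> p z" "\<And>z. p z \<le> p1" and q: "p1 < q0" "\<And>z. q0 \<le> q z"
    and \<alpha>: "\<And>x. 0 < \<alpha> x" "\<And>x. \<alpha> x < 1" and \<beta>: "\<And>y. 0 < \<beta> y" "\<And>y. \<beta> y < 1"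
    and meas: "q \<in> borel_measurable lebesgue" "\<alpha> \<in> borel_measurable lebesgue"
      "\<beta> \<in> borel_measurable lebesgue" "v \<in> borel_measurable lebesgue"
  obtains c :: real where "0 < c"
    and "\<And>f l. f \<in> borel_measurable lebesgue \<Longrightarrow> 0 < l \<Longrightarrow>
      (\<integral>\<^sup>+z. ennpow (ennreal \<bar>f z\<bar> * max (weight_maximal_exp p0 q \<alpha> \<beta> v z) (weight_maximal_exp p1 q \<alpha> \<beta> v z)
          / ennreal l) (p z) \<partial>lebesgue) \<le> 1 \<Longrightarrow>
      (\<integral>\<^sup>+z. ennpow (strong_maximal \<alpha> \<beta> f z * ennreal \<bar>v z\<bar> / ennreal (c * l)) (q z) \<partial>lebesgue) \<le> 1"
proof -
  have p01: "p0 \<le> p1" using p(2,3) order_trans by blast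
  have q0: "1 < q0" and p1: "1 < p1" using p p01 q by linarith+
  have "p0 < q0" using p01 q by linarith
  from rectangle_embedding_lebesgue[OF p(1) this]
  obtain C0 where C0: "0 < C0" and emb0: "\<And>G. G \<in> borel_measurable lebesgue \<Longrightarrow>
      (\<integral>\<^sup>+z. ennpow (G z) p0 \<partial>lebesgue) \<le> 1 \<Longrightarrow>
      (\<integral>\<^sup>+R. ennpow (ennreal (tripled_area R powr (- (1 - 1 / p0)))
            * (\<integral>\<^sup>+z\<in>tripled_rectangle R. G z \<partial>lebesgue)) q0 \<partial>count_space UNIV) \<le> ennreal C0"
    by blast
  from rectangle_embedding_lebesgue[OF p1 q(1)]
  obtain C1 where C1: "0 < C1" and emb1: "\<And>G. G \<in> borel_measurable lebesgue \<Longrightarrow>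
      (\<integral>\<^sup>+z. ennpow (G z) p1 \<partial>lebesgue) \<le> 1 \<Longrightarrow>
      (\<integral>\<^sup>+R. ennpow (ennreal (tripled_area R powr (- (1 - 1 / p1)))
            * (\<integral>\<^sup>+z\<in>tripled_rectangle R. G z \<partial>lebesgue)) q0 \<partial>count_space UNIV) \<le> ennreal C1"
    by blast
  \<comment> \<open>Large enough that \<open>2 T R \<le> 1\<close> below, and that the final sum \<open>4 (C0 + C1) / c\<close> is at most \<open>1\<close>.\<close>
  define c where "c = 4 * (1 + C0 + C1)"
  have c: "0 < c" using C0 C1 by (simp add: c_def)
  define N where "N R = var_norm (tripled_rectangle R) q (rectangle_weight \<alpha> \<beta> v R)" for R
  \<comment> \<open>A minorant of the weight maximal function that is measurable, being a supremum over countably many rectangles.\<close>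
  define m where "m z = (SUP R. indicator (tripled_rectangle R) z *
      max (ennreal (tripled_area R powr (- (1 / p0))) * N R) (ennreal (tripled_area R powr (- (1 / p1))) * N R))" for z
  have [measurable]: "m \<in> borel_measurable lebesgue"
    unfolding m_def by measurable
  have m_le: "m z \<le> max (weight_maximal_exp p0 q \<alpha> \<beta> v z) (weight_maximal_exp p1 q \<alpha> \<beta> v z)" for z
    unfolding m_def N_def
    by (intro SUP_least) (auto split: split_indicator intro: max.coboundedI1 max.coboundedI2 weight_maximal_exp_ge)
  have N_le: "N R \<le> ennreal (tripled_area R powr (1 / r)) * m z"
    if z: "z \<in> tripled_rectangle R" and r: "r = p0 \<or> r = p1" for R z r
  proof -
    have "ennreal (tripled_area R powr (- (1 / r))) * N R
        \<le> indicator (tripled_rectangle R) z *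
          max (ennreal (tripled_area R powr (- (1 / p0))) * N R) (ennreal (tripled_area R powr (- (1 / p1))) * N R)"
      using z r by auto
    also have "\<dots> \<le> m z"
      unfolding m_def by (rule SUP_upper) simp
    finally have "ennreal (tripled_area R powr (1 / r)) * (ennreal (tripled_area R powr (- (1 / r))) * N R)
        \<le> ennreal (tripled_area R powr (1 / r)) * m z"
      by (rule mult_left_mono) simp
    moreover have "ennreal (tripled_area R powr (1 / r)) * ennreal (tripled_area R powr (- (1 / r))) = 1"
      by (simp add: order_less_imp_not_eq2 flip: ennreal_mult powr_add)
    ultimately show ?thesis
      by (simp flip: mult.assoc)
  qed
  show thesis
  proof (rule that[of "36 * c"])
    show "0 < 36 * c" using c by simp
    fix f :: "real \<times> real \<Rightarrow> real" and l :: real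
    assume [measurable]: "f \<in> borel_measurable lebesgue" and l: "0 < l"
      and int: "(\<integral>\<^sup>+z. ennpow (ennreal \<bar>f z\<bar> * max (weight_maximal_exp p0 q \<alpha> \<beta> v z) (weight_maximal_exp p1 q \<alpha> \<beta> v z)
          / ennreal l) (p z) \<partial>lebesgue) \<le> 1"
    define h where "h z = ennreal (\<bar>f z\<bar> / l)" for z
    define g where "g z = h z * m z" for z
    define g0 where "g0 z = g z * indicator {z. 1 < g z} z" for z
    define g1 where "g1 z = g z * indicator {z. g z \<le> 1} z" for z
    have [measurable]: "h \<in> borel_measurable lebesgue" "g \<in> borel_measurable lebesgue"
      "g0 \<in> borel_measurable lebesgue" "g1 \<in> borel_measurable lebesgue"
      unfolding h_def g_def g0_def g1_def by measurable
    have g_le: "g z \<le> ennreal \<bar>f z\<bar> * max (weight_maximal_exp p0 q \<alpha> \<beta> v z) (weight_maximal_exp p1 q \<alpha> \<beta> v z)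
          / ennreal l" for z
    proof -
      have "g z \<le> h z * max (weight_maximal_exp p0 q \<alpha> \<beta> v z) (weight_maximal_exp p1 q \<alpha> \<beta> v z)"
        unfolding g_def by (intro mult_left_mono m_le) simp
      also have "h z = ennreal \<bar>f z\<bar> / ennreal l"
        using l by (simp add: h_def divide_ennreal)
      finally show ?thesis
        by (simp add: divide_ennreal_def mult_ac)
    qed
    have "(\<integral>\<^sup>+z. ennpow (g z) (p z) \<partial>lebesgue) \<le> 1"
      using p by (intro order_trans[OF nn_integral_mono int] ennpow_mono g_le) (smt (verit))
    moreover have "(\<integral>\<^sup>+z. ennpow (g0 z) p0 \<partial>lebesgue) \<le> (\<integral>\<^sup>+z. ennpow (g z) (p z) \<partial>lebesgue)"
      using p by (intro nn_integral_mono) (auto simp: g0_def ennpow_mono_exponent split: split_indicator)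
    moreover have "(\<integral>\<^sup>+z. ennpow (g1 z) p1 \<partial>lebesgue) \<le> (\<integral>\<^sup>+z. ennpow (g z) (p z) \<partial>lebesgue)"
    proof (intro nn_integral_mono)
      fix z
      have "0 < p z" using p(1) p(2)[of z] by linarith
      then show "ennpow (g1 z) p1 \<le> ennpow (g z) (p z)"
        using p by (auto simp: g1_def ennpow_antimono_exponent split: split_indicator)
    qed
    ultimately have int0: "(\<integral>\<^sup>+z. ennpow (g0 z) p0 \<partial>lebesgue) \<le> 1"
      and int1: "(\<integral>\<^sup>+z. ennpow (g1 z) p1 \<partial>lebesgue) \<le> 1"
      by (auto intro: order_trans)
    define X where "X R = ennreal (tripled_area R powr (- (1 - 1 / p0))) * (\<integral>\<^sup>+z\<in>tripled_rectangle R. g0 z \<partial>lebesgue)" for R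
    define Y where "Y R = ennreal (tripled_area R powr (- (1 - 1 / p1))) * (\<integral>\<^sup>+z\<in>tripled_rectangle R. g1 z \<partial>lebesgue)" for R
    have sumX: "(\<integral>\<^sup>+R. ennpow (X R) q0 \<partial>count_space UNIV) \<le> ennreal C0"
      unfolding X_def by (rule emb0[OF _ int0]) measurable
    have sumY: "(\<integral>\<^sup>+R. ennpow (Y R) q0 \<partial>count_space UNIV) \<le> ennreal C1"
      unfolding Y_def by (rule emb1[OF _ int1]) measurable
    define a where "a R = ennreal (1 / (tripled_area R * c)) * (\<integral>\<^sup>+z\<in>tripled_rectangle R. h z \<partial>lebesgue)" for R
    define T where "T R = ennreal (1 / c) * (X R + Y R)" for R
    have Na: "N R * a R \<le> T R" for R
    proof -
      let ?s0 = "ennreal (tripled_area R powr (1 / p0))" and ?s1 = "ennreal (tripled_area R powr (1 / p1))"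
      have pointwise: "N R * h z \<le> ?s0 * g0 z + ?s1 * g1 z" if z: "z \<in> tripled_rectangle R" for z
      proof (cases "1 < g z")
        case True
        then show ?thesis
          using mult_right_mono[OF N_le[OF z, of p0], of "h z"] by (simp add: g0_def g1_def g_def mult_ac)
      next
        case False
        then show ?thesis
          using mult_right_mono[OF N_le[OF z, of p1], of "h z"] by (simp add: g0_def g1_def g_def mult_ac)
      qed
      have "N R * (\<integral>\<^sup>+z\<in>tripled_rectangle R. h z \<partial>lebesgue)
          = (\<integral>\<^sup>+z. N R * (h z * indicator (tripled_rectangle R) z) \<partial>lebesgue)"
        by (rule nn_integral_cmult[symmetric]) measurable
      also have "\<dots> \<le> (\<integral>\<^sup>+z. ?s0 * (g0 z * indicator (tripled_rectangle R) z)
          + ?s1 * (g1 z * indicator (tripled_rectangle R) z) \<partial>lebesgue)"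
        using pointwise by (intro nn_integral_mono) (auto split: split_indicator)
      also have "\<dots> = ?s0 * (\<integral>\<^sup>+z\<in>tripled_rectangle R. g0 z \<partial>lebesgue)
          + ?s1 * (\<integral>\<^sup>+z\<in>tripled_rectangle R. g1 z \<partial>lebesgue)"
        by (simp add: nn_integral_add nn_integral_cmult)
      finally have "ennreal (1 / (tripled_area R * c)) * (N R * (\<integral>\<^sup>+z\<in>tripled_rectangle R. h z \<partial>lebesgue))
         \<le> ennreal (1 / (tripled_area R * c)) * (?s0 * (\<integral>\<^sup>+z\<in>tripled_rectangle R. g0 z \<partial>lebesgue)
          + ?s1 * (\<integral>\<^sup>+z\<in>tripled_rectangle R. g1 z \<partial>lebesgue))"
        by (rule mult_left_mono) simp
      also have "\<dots> = T R"
      proof -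
        have "ennreal (1 / (tripled_area R * c)) * ennreal (tripled_area R powr (1 / r))
            = ennreal (1 / c) * ennreal (tripled_area R powr (- (1 - 1 / r)))" for r
        proof -
          have "tripled_area R powr (- (1 - 1 / r)) = tripled_area R powr (1 / r) / tripled_area R"
            by (simp add: powr_diff abs_of_pos)
          then show ?thesis
            using c by (simp add: less_imp_le flip: ennreal_mult)
        qed
        then show ?thesis
          by (simp add: T_def X_def Y_def distrib_left flip: mult.assoc)
      qed
      finally show ?thesis by (simp add: a_def mult_ac)
    qed
    have T_small: "2 * T R \<le> 1" for R
    proof -
      have "ennpow (X R) q0 \<le> ennreal C0"
        by (rule order_trans[OF nn_integral_ge_point sumX]) simp
      then have "X R \<le> ennreal (1 + C0)"
        using q0 C0 by (intro le_of_ennpow_le[of q0]) auto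
      moreover have "ennpow (Y R) q0 \<le> ennreal C1"
        by (rule order_trans[OF nn_integral_ge_point sumY]) simp
      then have "Y R \<le> ennreal (1 + C1)"
        using q0 C1 by (intro le_of_ennpow_le[of q0]) auto
      ultimately have "T R \<le> ennreal (1 / c) * (ennreal (1 + C0) + ennreal (1 + C1))"
        unfolding T_def by (intro mult_left_mono add_mono) auto
      also have "\<dots> = ennreal ((2 + C0 + C1) / c)"
        using c C0 C1 by (simp add: algebra_simps add_divide_distrib flip: ennreal_mult ennreal_plus)
      also have "\<dots> \<le> ennreal (1 / 2)"
        using c C0 C1 by (intro ennreal_leI) (simp add: c_def divide_simps)
      finally have "2 * T R \<le> 2 * ennreal (1 / 2)"
        by (rule mult_left_mono) simp
      also have "2 * ennreal (1 / 2) = 1"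
        by (subst ennreal_numeral[symmetric], subst ennreal_mult[symmetric]) auto
      finally show ?thesis .
    qed
    have local_modular: "(\<integral>\<^sup>+z\<in>tripled_rectangle R. ennpow (rectangle_weight \<alpha> \<beta> v R z * a R) (q z) \<partial>lebesgue)
        \<le> ennpow (2 * T R) q0" for R
      using q0 q(2) meas Na[of R] T_small[of R] unfolding N_def
      by (intro modular_le_var_norm rectangle_weight_measurable) auto
    define F where "F R z = indicator (tripled_rectangle R) z * (rectangle_weight \<alpha> \<beta> v R z * a R)" for R z
    have maximal_le: "strong_maximal \<alpha> \<beta> f z * ennreal \<bar>v z\<bar> / ennreal (36 * c * l) \<le> (SUP R. F R z)" for z
    proof (rule divide_le_posI_ennreal)
      obtain x y where z: "z = (x, y)" by (cases z)
      have term_eq: "indicator (tripled_rectangle R) z *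
          (ennreal (36 * (tripled_length (fst R) powr (\<alpha> x - 1) * tripled_length (snd R) powr (\<beta> y - 1)))
        * (\<integral>\<^sup>+z\<in>tripled_rectangle R. ennreal \<bar>f z\<bar> \<partial>lebesgue)) * ennreal \<bar>v z\<bar> = F R z * ennreal (36 * c * l)" for R
      proof -
        let ?A = "tripled_length (fst R)" and ?B = "tripled_length (snd R)"
        have "ennreal \<bar>f z\<bar> = ennreal l * h z" for z
          using l by (simp add: h_def flip: ennreal_mult)
        then have f_eq: "(\<integral>\<^sup>+z\<in>tripled_rectangle R. ennreal \<bar>f z\<bar> \<partial>lebesgue)
            = ennreal l * (\<integral>\<^sup>+z\<in>tripled_rectangle R. h z \<partial>lebesgue)" (is "?f = ennreal l * ?h")
          by (simp add: nn_integral_cmult mult.assoc)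
        have factors: "ennreal (36 * (?A powr (\<alpha> x - 1) * ?B powr (\<beta> y - 1))) * ennreal l * ennreal \<bar>v z\<bar>
            = rectangle_weight \<alpha> \<beta> v R z * ennreal (1 / (tripled_area R * c)) * ennreal (36 * c * l)"
        proof -
          have AB: "0 < ?A" "0 < ?B" by simp_all
          have "?A powr (\<alpha> x - 1) = ?A powr \<alpha> x / ?A" "?B powr (\<beta> y - 1) = ?B powr \<beta> y / ?B"
            using AB by (simp_all only: powr_diff powr_one abs_of_pos less_imp_le)
          then have "36 * (?A powr (\<alpha> x - 1) * ?B powr (\<beta> y - 1)) * l * \<bar>v z\<bar>
            = \<bar>v z\<bar> * ?A powr \<alpha> x * ?B powr \<beta> y * (1 / (?A * ?B * c)) * (36 * c * l)"
            using AB c by (simp only:) (simp add: field_simps)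
          moreover have "\<bar>v z * ?A powr \<alpha> x * ?B powr \<beta> y\<bar> = \<bar>v z\<bar> * ?A powr \<alpha> x * ?B powr \<beta> y"
            by (simp add: abs_mult)
          ultimately show ?thesis
            using l c AB by (simp add: z rectangle_weight_def tripled_area_def less_imp_le flip: ennreal_mult)
        qed
        have "indicator (tripled_rectangle R) z *
            (ennreal (36 * (?A powr (\<alpha> x - 1) * ?B powr (\<beta> y - 1))) * ?f) * ennreal \<bar>v z\<bar>
          = indicator (tripled_rectangle R) z * ?h
            * (ennreal (36 * (?A powr (\<alpha> x - 1) * ?B powr (\<beta> y - 1))) * ennreal l * ennreal \<bar>v z\<bar>)"
          by (simp only: f_eq mult_ac)
        also have "\<dots> = F R z * ennreal (36 * c * l)"
          unfolding factors F_def a_def by (simp only: mult_ac)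
        finally show ?thesis .
      qed
      have "strong_maximal \<alpha> \<beta> f z * ennreal \<bar>v z\<bar> \<le> (SUP R. indicator (tripled_rectangle R) z *
          (ennreal (36 * (tripled_length (fst R) powr (\<alpha> x - 1) * tripled_length (snd R) powr (\<beta> y - 1)))
        * (\<integral>\<^sup>+z\<in>tripled_rectangle R. ennreal \<bar>f z\<bar> \<partial>lebesgue))) * ennreal \<bar>v z\<bar>"
        unfolding z using \<alpha> \<beta> by (intro mult_right_mono strong_maximal_le) auto
      also have "\<dots> = (SUP R. indicator (tripled_rectangle R) z *
          (ennreal (36 * (tripled_length (fst R) powr (\<alpha> x - 1) * tripled_length (snd R) powr (\<beta> y - 1)))
        * (\<integral>\<^sup>+z\<in>tripled_rectangle R. ennreal \<bar>f z\<bar> \<partial>lebesgue)) * ennreal \<bar>v z\<bar>)"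
        by (rule SUP_mult_right_ennreal)
      also have "\<dots> = (SUP R. F R z * ennreal (36 * c * l))"
        by (simp only: term_eq)
      also have "\<dots> = (SUP R. F R z) * ennreal (36 * c * l)"
        by (rule SUP_mult_right_ennreal[symmetric])
      finally show "strong_maximal \<alpha> \<beta> f z * ennreal \<bar>v z\<bar> \<le> ennreal (36 * c * l) * (SUP R. F R z)"
        by (simp only: mult.commute)
    qed (use c l in simp)
    have q_pos: "0 < q z" for z using q0 q(2)[of z] by linarith
    note [measurable] = meas rectangle_weight_measurable[OF meas(2-4)]
    have "(\<integral>\<^sup>+z. ennpow (strong_maximal \<alpha> \<beta> f z * ennreal \<bar>v z\<bar> / ennreal (36 * c * l)) (q z) \<partial>lebesgue)
       \<le> (\<integral>\<^sup>+z. (\<integral>\<^sup>+R. ennpow (F R z) (q z) \<partial>count_space UNIV) \<partial>lebesgue)"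
      by (intro nn_integral_mono ennpow_le_sum q_pos maximal_le)
    also have "\<dots> = (\<integral>\<^sup>+R. (\<integral>\<^sup>+z. ennpow (F R z) (q z) \<partial>lebesgue) \<partial>count_space UNIV)"
      unfolding F_def by (rule nn_integral_count_space_nn_integral) auto
    also have "\<dots> \<le> (\<integral>\<^sup>+R. ennpow (2 * T R) q0 \<partial>count_space UNIV)"
    proof (intro nn_integral_mono order_trans[OF _ local_modular])
      fix R z
      show "ennpow (F R z) (q z) \<le> ennpow (rectangle_weight \<alpha> \<beta> v R z * a R) (q z) * indicator (tripled_rectangle R) z"
        by (simp add: F_def split: split_indicator)
    qed
    also have "\<dots> \<le> (\<integral>\<^sup>+R. ennreal (4 / c) * (ennpow (X R) q0 + ennpow (Y R) q0) \<partial>count_space UNIV)"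
    proof (intro nn_integral_mono)
      fix R
      have "2 * T R = ennreal (2 / c) * (X R + Y R)"
        using c by (simp add: T_def mult.assoc[symmetric] flip: ennreal_numeral ennreal_mult)
      then have "ennpow (2 * T R) q0 = ennreal ((2 / c) powr q0) * ennpow (X R + Y R) q0"
        using c by (simp add: ennpow_mult ennpow_ennreal)
      also have "\<dots> \<le> ennreal ((2 / c) powr q0) * (ennreal (2 powr q0) * (ennpow (X R) q0 + ennpow (Y R) q0))"
        using q0 by (intro mult_left_mono ennpow_add_le) auto
      also have "\<dots> = ennreal ((4 / c) powr q0) * (ennpow (X R) q0 + ennpow (Y R) q0)"
        using c by (simp add: mult.assoc[symmetric] flip: ennreal_mult powr_mult)
      also have "\<dots> \<le> ennreal (4 / c) * (ennpow (X R) q0 + ennpow (Y R) q0)"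
      proof (intro mult_right_mono ennreal_leI)
        have "(4 / c) powr q0 \<le> (4 / c) powr 1"
          using q0 c C0 C1 by (intro powr_mono') (auto simp: c_def)
        then show "(4 / c) powr q0 \<le> 4 / c" using c by simp
      qed simp
      finally show "ennpow (2 * T R) q0 \<le> ennreal (4 / c) * (ennpow (X R) q0 + ennpow (Y R) q0)" .
    qed
    also have "\<dots> = ennreal (4 / c) * ((\<integral>\<^sup>+R. ennpow (X R) q0 \<partial>count_space UNIV)
        + (\<integral>\<^sup>+R. ennpow (Y R) q0 \<partial>count_space UNIV))"
      by (simp add: nn_integral_cmult nn_integral_add)
    also have "\<dots> \<le> ennreal (4 / c) * (ennreal C0 + ennreal C1)"
      by (intro mult_left_mono add_mono sumX sumY) auto
    also have "\<dots> = ennreal (4 / c * (C0 + C1))"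
      using c C0 C1 by (simp flip: ennreal_mult ennreal_plus)
    also have "\<dots> \<le> 1"
      using c C0 C1 by (simp add: c_def divide_simps ennreal_le_1)
    finally show "(\<integral>\<^sup>+z. ennpow (strong_maximal \<alpha> \<beta> f z * ennreal \<bar>v z\<bar> / ennreal (36 * c * l)) (q z) \<partial>lebesgue) \<le> 1" .
  qed
qed

theorem theorem4p1:
  fixes p q :: "real \<times> real \<Rightarrow> real" and \<alpha> \<beta> :: "real \<Rightarrow> real" and v :: "real \<times> real \<Rightarrow> real"
  assumes "p \<in> borel_measurable lebesgue" and "q \<in> borel_measurable lebesgue"
    and "\<alpha> \<in> borel_measurable lebesgue" and "\<beta> \<in> borel_measurable lebesgue"
    and "bounded (range p)" and "bounded (range q)"
    and "bounded (range \<alpha>)" and "bounded (range \<beta>)"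
    and "1 < Inf (range p)" and "Inf (range p) \<le> Sup (range p)"
    and "Sup (range p) < Inf (range q)" and "Inf (range q) \<le> Sup (range q)"
    and "1 / Inf (range p) - 1 / Sup (range q) < Inf (range \<alpha>)"
    and "Inf (range \<alpha>) \<le> Sup (range \<alpha>)" and "Sup (range \<alpha>) < 1 / Inf (range p)"
    and "1 / Inf (range p) - 1 / Sup (range q) < Inf (range \<beta>)"
    and "Inf (range \<beta>) \<le> Sup (range \<beta>)" and "Sup (range \<beta>) < 1 / Inf (range p)"
    and "weight v"
  shows "\<exists>c::real. 0 < c \<and>
    (\<forall>f \<in> borel_measurable lebesgue.
       var_norm UNIV q (\<lambda>z. strong_maximal \<alpha> \<beta> f z * ennreal \<bar>v z\<bar>)
         \<le> ennreal c * var_norm UNIV p (\<lambda>z. ennreal \<bar>f z\<bar> * weight_maximal p q \<alpha> \<beta> v z))"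
proof -
  have le_range: "Inf (range F) \<le> F z" "F z \<le> Sup (range F)" if "bounded (range F)" for F :: "'z \<Rightarrow> real" and z
    using that by (auto intro: cInf_lower cSup_upper bounded_imp_bdd_below bounded_imp_bdd_above)
  have "1 / Sup (range q) \<le> 1 / Inf (range p)"
    using assms(9-12) by (intro divide_left_mono) auto
  moreover have "1 / Inf (range p) < 1"
    using assms(9) by simp
  ultimately have \<alpha>: "0 < \<alpha> x" "\<alpha> x < 1" and \<beta>: "0 < \<beta> x" "\<beta> x < 1" for x
    using assms(13-18) le_range[OF assms(7), of x] le_range[OF assms(8), of x] by linarith+
  have v: "v \<in> borel_measurable lebesgue"
    using assms(19) by (simp add: weight_def)
  obtain c where c: "0 < c" and modular: "\<And>f l. f \<in> borel_measurable lebesgue \<Longrightarrow> 0 < l \<Longrightarrow>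
      (\<integral>\<^sup>+z. ennpow (ennreal \<bar>f z\<bar> * weight_maximal p q \<alpha> \<beta> v z / ennreal l) (p z) \<partial>lebesgue) \<le> 1 \<Longrightarrow>
      (\<integral>\<^sup>+z. ennpow (strong_maximal \<alpha> \<beta> f z * ennreal \<bar>v z\<bar> / ennreal (c * l)) (q z) \<partial>lebesgue) \<le> 1"
    unfolding weight_maximal_def
    by (rule modular_estimate[of _ p _ _ q, OF assms(9) le_range[OF assms(5)] assms(11)
          le_range(1)[OF assms(6)] \<alpha> \<beta> assms(2-4) v]) blast
  show ?thesis
    using c modular by (intro exI[of _ c] conjI ballI var_norm_le_of_modular) auto
qed

end
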